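(* Let $[\mathfrak{A}^L,\mathbf{A}^L]$ be a normed nonlinear ideal and let $0\le\theta,\theta_1,\theta_2<1$. Then the following hold. (a) $\mathfrak{A}^L_{\theta_1}\subset\mathfrak{A}^L_{\theta_2}$ if $\theta_1\le\theta_2$. (b) $\mathfrak{A}^L_{\mathrm{inj}}\subset\mathfrak{A}^L_\theta$. (c) $\left(\mathfrak{A}^L_{\theta_1}\right)_{\theta_2}\subset\mathfrak{A}^L_{\theta_1+\theta_2-\theta_1\theta_2}$. (Inclusions, not necessarily strict, hold for all components $(X,F)$, with $X$ a metric space and $F$ a Banach space.)
   Context: Metric spaces are pointed with distinguished point $0$ (the origin in a Banach space). $\mathrm{Lip}(X,F)$ is the Banach space of Lipschitz maps $T:X\to F$ with $T0=0$, normed by the Lipschitz constant $\mathrm{Lip}(T)$; for pointed metric spaces $X_0,X$, $\mathrm{Lip}(X_0,X)$ is the set of base-point preserving Lipschitz maps; $X^{\#}$ is the Banach space of scalar-valued Lipschitz functions on $X$ vanishing at $0$. For $g\in X^{\#}$, $e\in F$, $(g\boxdot e)(x)=g(x)e$. $\mathfrak{L}(F,F_0)$ denotes bounded linear operators. Normed nonlinear ideal $[\mathfrak{A}^L,\mathbf{A}^L]$: for every metric space $X$ and Banach space $F$ a subset $\mathfrak{A}^L(X,F)\subseteq\mathrm{Lip}(X,F)$, and a function $\mathbf{A}^L:\mathfrak{A}^L\to[0,\infty)$, such that (0) $g\boxdot e\in\mathfrak{A}^L(X,F)$ and $\mathbf{A}^L(g\boxdot e)=\mathrm{Lip}(g)\|e\|$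 for $g\in X^{\#}$, $e\in F$; (1) $S+T\in\mathfrak{A}^L(X,F)$ and $\mathbf{A}^L(S+T)\le\mathbf{A}^L(S)+\mathbf{A}^L(T)$ for $S,T\in\mathfrak{A}^L(X,F)$; (2) $BTA\in\mathfrak{A}^L(X_0,F_0)$ and $\mathbf{A}^L(BTA)\le\|B\|\mathbf{A}^L(T)\mathrm{Lip}(A)$ for $A\in\mathrm{Lip}(X_0,X)$, $T\in\mathfrak{A}^L(X,F)$, $B\in\mathfrak{L}(F,F_0)$. Let $F^{\mathrm{inj}}=\ell_\infty(B_{F^*})$ and $J_F:F\to F^{\mathrm{inj}}$, $J_Fx=(\langle x,a\rangle)_{a\in B_{F^*}}$; $\mathfrak{A}^L_{\mathrm{inj}}(X,F)=\{T\in\mathrm{Lip}(X,F): J_FT\in\mathfrak{A}^L(X,F^{\mathrm{inj}})\}$. For $0\le\theta<1$, $T\in\mathrm{Lip}(X,F)$ belongs to $\mathfrak{A}^L_\theta(X,F)$ if there exist a Banach space $G$ and $S\in\mathfrak{A}^L(X,G)$ with $\|Tx'-Tx''\|\le\|Sx'-Sx''\|^{1-\theta}d_X(x',x'')^{\theta}$ for all $x',x''\in X$; $\mathbf{A}^L_\theta(T)=\inf\mathbf{A}^L(S)^{1-\theta}$ over all such $S$. $(\mathfrak{A}^L_{\theta_1})_{\theta_2}$ is obtained by applying this construction with parameter $\theta_2$ to $\mathfrak{A}^L_{\theta_1}$. *)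

theory Defs
  imports "HOL-Analysis.Analysis" "HOL-Algebra.Module"
begin

text \<open>Maps between spaces given by carriers are extensional, so that two maps that agree on
  the carrier of their domain are equal.\<close>

type_synonym 'm pmetric = "'m metric \<times> 'm"

abbreviation points :: "'m pmetric \<Rightarrow> 'm set"
  where "points X \<equiv> mspace (fst X)"

definition pointed :: "'m pmetric \<Rightarrow> bool"
  where "pointed X \<longleftrightarrow> snd X \<in> points X"

definition Lip :: "'m pmetric \<Rightarrow> 'n pmetric \<Rightarrow> ('m \<Rightarrow> 'n) set"
  where "Lip X Y = {f \<in> extensional (points X).
     Lipschitz_continuous_map (fst X) (fst Y) f \<and> f (snd X) = snd Y}"

definition Lip_const :: "'m pmetric \<Rightarrow> 'n pmetric \<Rightarrow> ('m \<Rightarrow> 'n) \<Rightarrow> real"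
  where "Lip_const X Y f = Inf {C. 0 \<le> C \<and>
     (\<forall>x\<in>points X. \<forall>y\<in>points X. mdist (fst Y) (f x) (f y) \<le> C * mdist (fst X) x y)}"

text \<open>
  The scalars are a type \<^typ>\<open>'k\<close> of sort \<open>{real_normed_field, euclidean_space}\<close>. By the
  Gelfand--Mazur theorem the real and the complex numbers are, up to isomorphism, the only
  such fields. A normed space inherits the components \<^const>\<open>one\<close> and \<^const>\<open>monoid.mult\<close> from
  the record of modules; they are used only for the scalar field itself.
\<close>

record ('k, 'v) nspace = "('k, 'v) module" +
  nrm :: "'v \<Rightarrow> real" (\<open>\<Vert>_\<Vert>\<index>\<close>)

definition scalar_space :: "('k::{real_normed_field, euclidean_space}, 'k) nspace"
  where "scalar_space = \<lparr>carrier = UNIV, monoid.mult = (*), one = 1, ring.zero = 0, add = (+),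
     smult = (*), nrm = norm\<rparr>"

text \<open>The type of metrics requires symmetry and nonnegativity of the distance also off the
  carrier, hence the case distinction.\<close>

definition nmetric :: "('k, 'v) nspace \<Rightarrow> 'v metric"
  where "nmetric F = metric (carrier F,
     \<lambda>x y. if x \<in> carrier F \<and> y \<in> carrier F then \<Vert>x \<ominus>\<^bsub>F\<^esub> y\<Vert>\<^bsub>F\<^esub> else 0)"

definition npointed :: "('k, 'v) nspace \<Rightarrow> 'v pmetric"
  where "npointed F = (nmetric F, \<zero>\<^bsub>F\<^esub>)"

definition banach_space :: "('k::{real_normed_field, euclidean_space}, 'v) nspace \<Rightarrow> bool"
  where "banach_space F \<longleftrightarrow>
     Module.module (scalar_space :: ('k, 'k) nspace) F \<and>
     (\<forall>x\<in>carrier F. 0 \<le> \<Vert>x\<Vert>\<^bsub>F\<^esub> \<and> (\<Vert>x\<Vert>\<^bsub>F\<^esub> = 0 \<longleftrightarrow> x = \<zero>\<^bsub>F\<^esub>)) \<and>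
     (\<forall>c. \<forall>x\<in>carrier F. \<Vert>c \<odot>\<^bsub>F\<^esub> x\<Vert>\<^bsub>F\<^esub> = norm c * \<Vert>x\<Vert>\<^bsub>F\<^esub>) \<and>
     (\<forall>x\<in>carrier F. \<forall>y\<in>carrier F. \<Vert>x \<oplus>\<^bsub>F\<^esub> y\<Vert>\<^bsub>F\<^esub> \<le> \<Vert>x\<Vert>\<^bsub>F\<^esub> + \<Vert>y\<Vert>\<^bsub>F\<^esub>) \<and>
     mcomplete_of (nmetric F)"

definition bounded_ops ::
    "('k, 'v) nspace \<Rightarrow> ('k, 'w) nspace \<Rightarrow> ('v \<Rightarrow> 'w) set"
  where "bounded_ops F G = {B \<in> carrier F \<rightarrow>\<^sub>E carrier G.
     (\<forall>x\<in>carrier F. \<forall>y\<in>carrier F. B (x \<oplus>\<^bsub>F\<^esub> y) = B x \<oplus>\<^bsub>G\<^esub> B y) \<and>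
     (\<forall>c. \<forall>x\<in>carrier F. B (c \<odot>\<^bsub>F\<^esub> x) = c \<odot>\<^bsub>G\<^esub> B x) \<and>
     (\<exists>C. \<forall>x\<in>carrier F. \<Vert>B x\<Vert>\<^bsub>G\<^esub> \<le> C * \<Vert>x\<Vert>\<^bsub>F\<^esub>)}"

definition op_norm :: "('k, 'v) nspace \<Rightarrow> ('k, 'w) nspace \<Rightarrow> ('v \<Rightarrow> 'w) \<Rightarrow> real"
  where "op_norm F G B = Inf {C. 0 \<le> C \<and> (\<forall>x\<in>carrier F. \<Vert>B x\<Vert>\<^bsub>G\<^esub> \<le> C * \<Vert>x\<Vert>\<^bsub>F\<^esub>)}"

definition isometric_iso :: "('k, 'v) nspace \<Rightarrow> ('k, 'w) nspace \<Rightarrow> ('v \<Rightarrow> 'w) \<Rightarrow> bool"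
  where "isometric_iso F G \<Phi> \<longleftrightarrow> \<Phi> \<in> bounded_ops F G \<and> bij_betw \<Phi> (carrier F) (carrier G) \<and>
     (\<forall>x\<in>carrier F. \<Vert>\<Phi> x\<Vert>\<^bsub>G\<^esub> = \<Vert>x\<Vert>\<^bsub>F\<^esub>)"

definition dual_ball ::
    "('k::{real_normed_field, euclidean_space}, 'v) nspace \<Rightarrow> ('v \<Rightarrow> 'k) set"
  where "dual_ball F = {a \<in> bounded_ops F scalar_space. op_norm F scalar_space a \<le> 1}"

definition linfty :: "'i set \<Rightarrow> ('k::{real_normed_field, euclidean_space}, 'i \<Rightarrow> 'k) nspace"
  where "linfty \<Gamma> = \<lparr>carrier = {f \<in> extensional \<Gamma>. bounded (f ` \<Gamma>)},
     monoid.mult = (\<lambda>f g. \<lambda>i\<in>\<Gamma>. f i * g i), one = (\<lambda>i\<in>\<Gamma>. 1),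
     ring.zero = (\<lambda>i\<in>\<Gamma>. 0), add = (\<lambda>f g. \<lambda>i\<in>\<Gamma>. f i + g i),
     smult = (\<lambda>c f. \<lambda>i\<in>\<Gamma>. c * f i),
     nrm = (\<lambda>f. if \<Gamma> = {} then 0 else SUP i\<in>\<Gamma>. norm (f i))\<rparr>"

definition inj_space :: "('k::{real_normed_field, euclidean_space}, 'v) nspace
     \<Rightarrow> ('k, ('v \<Rightarrow> 'k) \<Rightarrow> 'k) nspace"
  where "inj_space F = linfty (dual_ball F)"

definition inj_emb :: "('k::{real_normed_field, euclidean_space}, 'v) nspace
     \<Rightarrow> 'v \<Rightarrow> ('v \<Rightarrow> 'k) \<Rightarrow> 'k"
  where "inj_emb F = (\<lambda>x\<in>carrier F. \<lambda>a\<in>dual_ball F. a x)"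

text \<open>
  There is no type of all metric spaces or of all Banach spaces. An ideal is therefore a family
  indexed by the pointed metric spaces with points in a type \<^typ>\<open>'m\<close> and the Banach
  spaces with vectors in a type \<^typ>\<open>'u\<close>. Both types are arbitrary, so they can be taken large
  enough to contain copies of any given spaces.
\<close>

type_synonym ('m, 'k, 'u) components = "'m pmetric \<Rightarrow> ('k, 'u) nspace \<Rightarrow> ('m \<Rightarrow> 'u) set"

definition normed_nonlinear_ideal ::
    "('m, 'k::{real_normed_field, euclidean_space}, 'u) components \<Rightarrow>
     ('m pmetric \<Rightarrow> ('k, 'u) nspace \<Rightarrow> ('m \<Rightarrow> 'u) \<Rightarrow> real) \<Rightarrow> bool"
  where "normed_nonlinear_ideal \<AA> \<alpha> \<longleftrightarrow>
     (\<forall>X F. pointed X \<longrightarrow> banach_space F \<longrightarrow>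
        \<AA> X F \<subseteq> Lip X (npointed F) \<and>
        (\<forall>T\<in>\<AA> X F. 0 \<le> \<alpha> X F T) \<and>
        (\<forall>g\<in>Lip X (npointed scalar_space). \<forall>e\<in>carrier F.
           (\<lambda>x\<in>points X. g x \<odot>\<^bsub>F\<^esub> e) \<in> \<AA> X F \<and>
           \<alpha> X F (\<lambda>x\<in>points X. g x \<odot>\<^bsub>F\<^esub> e)
             = Lip_const X (npointed scalar_space) g * \<Vert>e\<Vert>\<^bsub>F\<^esub>) \<and>
        (\<forall>S\<in>\<AA> X F. \<forall>T\<in>\<AA> X F.
           (\<lambda>x\<in>points X. S x \<oplus>\<^bsub>F\<^esub> T x) \<in> \<AA> X F \<and>
           \<alpha> X F (\<lambda>x\<in>points X. S x \<oplus>\<^bsub>F\<^esub> T x) \<le> \<alpha> X F S + \<alpha> X F T)) \<and>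
     (\<forall>X\<^sub>0 X F F\<^sub>0. pointed X\<^sub>0 \<longrightarrow> pointed X \<longrightarrow> banach_space F \<longrightarrow> banach_space F\<^sub>0 \<longrightarrow>
        (\<forall>A\<in>Lip X\<^sub>0 X. \<forall>T\<in>\<AA> X F. \<forall>B\<in>bounded_ops F F\<^sub>0.
           (\<lambda>x\<in>points X\<^sub>0. B (T (A x))) \<in> \<AA> X\<^sub>0 F\<^sub>0 \<and>
           \<alpha> X\<^sub>0 F\<^sub>0 (\<lambda>x\<in>points X\<^sub>0. B (T (A x)))
             \<le> op_norm F F\<^sub>0 B * \<alpha> X F T * Lip_const X\<^sub>0 X A))"

text \<open>
  The vectors of \<^term>\<open>inj_space F\<close> have type \<^typ>\<open>('v \<Rightarrow> 'k) \<Rightarrow> 'k\<close>, which need not be the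
  type \<^typ>\<open>'u\<close> of the vectors on which the ideal is defined. Membership of \<open>J\<^sub>F T\<close> in the ideal
  is therefore tested on an isometric copy \<open>H\<close> of \<^term>\<open>inj_space F\<close>; by the ideal property the
  choice of the copy is immaterial (\<open>inj_hull_copy\<close>). The space \<open>F\<close> may have vectors of any type,
  and for \<open>'u = ('v \<Rightarrow> 'k) \<Rightarrow> 'k\<close> the space \<^term>\<open>inj_space F\<close> itself can serve
  as \<open>H\<close> (\<open>inj_hull_iff\<close>).
\<close>

definition inj_hull :: "('m, 'k::{real_normed_field, euclidean_space}, 'u) components
     \<Rightarrow> ('m, 'k, 'v) components"
  where "inj_hull \<AA> X F = {T \<in> Lip X (npointed F).
     \<exists>H \<Phi>. banach_space H \<and> isometric_iso (inj_space F) H \<Phi> \<and>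
       (\<lambda>x\<in>points X. \<Phi> (inj_emb F (T x))) \<in> \<AA> X H}"

text \<open>Here \<open>0 powr 0 = 0\<close>, but a zero base with a zero exponent only occurs for \<open>\<theta> = 0\<close> and
  \<open>x = y\<close>, where the left-hand side vanishes as well. The space \<open>G\<close> ranges over the Banach spaces on which
  the ideal is defined, whereas \<open>F\<close> may have vectors of any type.\<close>

definition interp :: "real \<Rightarrow> ('m, 'k::{real_normed_field, euclidean_space}, 'u) components
     \<Rightarrow> ('m, 'k, 'v) components"
  where "interp \<theta> \<AA> X F = {T \<in> Lip X (npointed F).
     \<exists>G S. banach_space G \<and> S \<in> \<AA> X G \<and>
       (\<forall>x\<in>points X. \<forall>y\<in>points X.
          \<Vert>T x \<ominus>\<^bsub>F\<^esub> T y\<Vert>\<^bsub>F\<^esub>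
            \<le> \<Vert>S x \<ominus>\<^bsub>G\<^esub> S y\<Vert>\<^bsub>G\<^esub> powr (1 - \<theta>) * mdist (fst X) x y powr \<theta>)}"

lemma cring_scalar_space: "cring (scalar_space :: ('k::{real_normed_field, euclidean_space}, 'k) nspace)"
proof (rule cringI)
  show "abelian_group (scalar_space :: ('k, 'k) nspace)"
  proof (rule abelian_groupI)
    fix x :: 'k
    show "\<exists>y\<in>carrier scalar_space. y \<oplus>\<^bsub>scalar_space\<^esub> x = \<zero>\<^bsub>scalar_space\<^esub>"
      by (rule bexI[of _ "- x"]) (simp_all add: scalar_space_def)
  qed (simp_all add: scalar_space_def)
  show "Group.comm_monoid (scalar_space :: ('k, 'k) nspace)"
    by (rule comm_monoidI) (simp_all add: scalar_space_def)
qed (simp add: scalar_space_def algebra_simps)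

lemma linfty_simps [simp]:
  "carrier (linfty \<Gamma>) = {f \<in> extensional \<Gamma>. bounded (f ` \<Gamma>)}"
  "\<zero>\<^bsub>linfty \<Gamma>\<^esub> = (\<lambda>i\<in>\<Gamma>. 0)"
  "f \<oplus>\<^bsub>linfty \<Gamma>\<^esub> g = (\<lambda>i\<in>\<Gamma>. f i + g i)"
  "c \<odot>\<^bsub>linfty \<Gamma>\<^esub> f = (\<lambda>i\<in>\<Gamma>. c * f i)"
  by (auto simp: linfty_def)

lemma linfty_norm_le_iff:
  assumes "f \<in> carrier (linfty \<Gamma>)" "0 \<le> C"
  shows "\<Vert>f\<Vert>\<^bsub>linfty \<Gamma>\<^esub> \<le> C \<longleftrightarrow> (\<forall>i\<in>\<Gamma>. norm (f i) \<le> C)"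
proof -
  have "bdd_above ((\<lambda>i. norm (f i)) ` \<Gamma>)"
    using assms(1) by (auto simp: bounded_iff bdd_above_def)
  then show ?thesis
    using assms(2) by (auto simp: linfty_def cSUP_le_iff)
qed

lemma linfty_norm_ge:
  assumes "f \<in> carrier (linfty \<Gamma>)" "i \<in> \<Gamma>"
  shows "norm (f i) \<le> \<Vert>f\<Vert>\<^bsub>linfty \<Gamma>\<^esub>"
proof -
  have "bdd_above ((\<lambda>i. norm (f i)) ` \<Gamma>)"
    using assms(1) by (auto simp: bounded_iff bdd_above_def)
  then show ?thesis
    using assms(2) by (auto simp: linfty_def intro: cSUP_upper)
qed

lemma linfty_norm_nonneg:
  assumes "f \<in> carrier (linfty \<Gamma>)"
  shows "0 \<le> \<Vert>f\<Vert>\<^bsub>linfty \<Gamma>\<^esub>"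
proof (cases "\<Gamma> = {}")
  case False
  then obtain i where "i \<in> \<Gamma>" by auto
  then show ?thesis using linfty_norm_ge[OF assms] norm_ge_zero order_trans by blast
qed (simp add: linfty_def)

lemma linfty_add_closed:
  assumes "f \<in> carrier (linfty \<Gamma>)" "g \<in> carrier (linfty \<Gamma>)"
  shows "f \<oplus>\<^bsub>linfty \<Gamma>\<^esub> g \<in> carrier (linfty \<Gamma>)"
proof -
  have "(\<lambda>i. f i + g i) ` \<Gamma> \<subseteq> (\<lambda>(x, y). x + y) ` (f ` \<Gamma> \<times> g ` \<Gamma>)" by auto
  then show ?thesis
    using assms bounded_plus_comp[of f \<Gamma> g] by (auto cong: image_cong_simp)
qed

lemma linfty_smult_closed:
  assumes "f \<in> carrier (linfty \<Gamma>)"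
  shows "c \<odot>\<^bsub>linfty \<Gamma>\<^esub> f \<in> carrier (linfty \<Gamma>)"
proof -
  obtain B where "\<And>i. i \<in> \<Gamma> \<Longrightarrow> norm (f i) \<le> B" using assms by (auto simp: bounded_iff)
  then show ?thesis
    using assms by (auto simp: bounded_iff norm_mult intro!: exI[of _ "norm c * B"] mult_left_mono)
qed

lemma module_linfty:
  "Module.module (scalar_space :: ('k::{real_normed_field, euclidean_space}, 'k) nspace)
     (linfty \<Gamma> :: ('k, 'i \<Rightarrow> 'k) nspace)"
proof (rule moduleI)
  show "abelian_group (linfty \<Gamma> :: ('k, 'i \<Rightarrow> 'k) nspace)"
  proof (rule abelian_groupI)
    fix f :: "'i \<Rightarrow> 'k" assume f: "f \<in> carrier (linfty \<Gamma>)"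
    show "\<exists>g\<in>carrier (linfty \<Gamma>). g \<oplus>\<^bsub>linfty \<Gamma>\<^esub> f = \<zero>\<^bsub>linfty \<Gamma>\<^esub>"
      by (rule bexI[OF _ linfty_smult_closed[OF f, of "-1"]]) (auto simp: restrict_def)
  next
    fix f g :: "'i \<Rightarrow> 'k" assume "f \<in> carrier (linfty \<Gamma>)" "g \<in> carrier (linfty \<Gamma>)"
    then show "f \<oplus>\<^bsub>linfty \<Gamma>\<^esub> g \<in> carrier (linfty \<Gamma>)" by (rule linfty_add_closed)
  qed (auto simp: fun_eq_iff extensional_def bounded_iff add_ac)
next
  fix c and f :: "'i \<Rightarrow> 'k" assume "f \<in> carrier (linfty \<Gamma>)"
  then show "c \<odot>\<^bsub>linfty \<Gamma>\<^esub> f \<in> carrier (linfty \<Gamma>)" by (rule linfty_smult_closed)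
qed (use cring_scalar_space in \<open>auto simp: fun_eq_iff extensional_def scalar_space_def algebra_simps\<close>)

lemma linfty_minus:
  assumes "f \<in> carrier (linfty \<Gamma> :: ('k::{real_normed_field, euclidean_space}, 'i \<Rightarrow> 'k) nspace)" "g \<in> carrier (linfty \<Gamma>)"
  shows "f \<ominus>\<^bsub>linfty \<Gamma>\<^esub> g = (\<lambda>i\<in>\<Gamma>. f i - g i)"
proof -
  interpret Module.module "scalar_space :: ('k, 'k) nspace" "linfty \<Gamma> :: ('k, 'i \<Rightarrow> 'k) nspace"
    by (rule module_linfty)
  let ?h = "(-1) \<odot>\<^bsub>linfty \<Gamma>\<^esub> g"
  have h: "?h \<in> carrier (linfty \<Gamma>)" by (rule linfty_smult_closed[OF assms(2)])
  have "\<ominus>\<^bsub>linfty \<Gamma>\<^esub> g = ?h"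
    by (rule minus_equality[OF _ assms(2) h]) (auto simp: restrict_def)
  then show ?thesis by (auto simp: a_minus_def restrict_def)
qed


lemma Metric_space_nmetric:
  fixes F :: "('k::{real_normed_field, euclidean_space}, 'v) nspace"
  assumes "Module.module (scalar_space :: ('k, 'k) nspace) F"
    and pos: "\<forall>x\<in>carrier F. 0 \<le> \<Vert>x\<Vert>\<^bsub>F\<^esub> \<and> (\<Vert>x\<Vert>\<^bsub>F\<^esub> = 0 \<longleftrightarrow> x = \<zero>\<^bsub>F\<^esub>)"
    and hom: "\<forall>c. \<forall>x\<in>carrier F. \<Vert>c \<odot>\<^bsub>F\<^esub> x\<Vert>\<^bsub>F\<^esub> = norm c * \<Vert>x\<Vert>\<^bsub>F\<^esub>"
    and tri: "\<forall>x\<in>carrier F. \<forall>y\<in>carrier F. \<Vert>x \<oplus>\<^bsub>F\<^esub> y\<Vert>\<^bsub>F\<^esub> \<le> \<Vert>x\<Vert>\<^bsub>F\<^esub> + \<Vert>y\<Vert>\<^bsub>F\<^esub>"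
  shows "Metric_space (carrier F)
    (\<lambda>x y. if x \<in> carrier F \<and> y \<in> carrier F then \<Vert>x \<ominus>\<^bsub>F\<^esub> y\<Vert>\<^bsub>F\<^esub> else 0)"
proof -
  interpret Module.module "scalar_space :: ('k, 'k) nspace" F by fact
  have sc: "c \<in> carrier (scalar_space :: ('k, 'k) nspace)" for c by (simp add: scalar_space_def)
  have one: "\<one>\<^bsub>scalar_space :: ('k, 'k) nspace\<^esub> = 1" by (simp add: scalar_space_def)
  have neg: "\<ominus>\<^bsub>scalar_space :: ('k, 'k) nspace\<^esub> 1 = -1"
    using R.minus_equality[of "-1" "1"] sc by (simp add: scalar_space_def)
  have minus: "\<ominus>\<^bsub>F\<^esub> x = (-1) \<odot>\<^bsub>F\<^esub> x" if "x \<in> carrier F" for x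
    using smult_l_minus[OF sc that, of 1] smult_one[OF that] by (simp add: one neg)
  have normm: "\<Vert>\<ominus>\<^bsub>F\<^esub> x\<Vert>\<^bsub>F\<^esub> = \<Vert>x\<Vert>\<^bsub>F\<^esub>" if "x \<in> carrier F" for x
    using hom that by (simp add: minus)
  have comm: "\<Vert>x \<ominus>\<^bsub>F\<^esub> y\<Vert>\<^bsub>F\<^esub> = \<Vert>y \<ominus>\<^bsub>F\<^esub> x\<Vert>\<^bsub>F\<^esub>" if "x \<in> carrier F" "y \<in> carrier F" for x y
  proof -
    have "y \<ominus>\<^bsub>F\<^esub> x = \<ominus>\<^bsub>F\<^esub> (x \<ominus>\<^bsub>F\<^esub> y)"
      using that by (simp add: a_minus_def M.minus_add M.a_comm)
    then show ?thesis using that normm by simp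
  qed
  show ?thesis
  proof
    fix x y z assume A: "x \<in> carrier F" "y \<in> carrier F" "z \<in> carrier F"
    have "x \<ominus>\<^bsub>F\<^esub> z = (x \<ominus>\<^bsub>F\<^esub> y) \<oplus>\<^bsub>F\<^esub> (y \<ominus>\<^bsub>F\<^esub> z)"
      using A by (simp add: a_minus_def M.a_assoc M.r_neg1)
    then show "(if x \<in> carrier F \<and> z \<in> carrier F then \<Vert>x \<ominus>\<^bsub>F\<^esub> z\<Vert>\<^bsub>F\<^esub> else 0)
      \<le> (if x \<in> carrier F \<and> y \<in> carrier F then \<Vert>x \<ominus>\<^bsub>F\<^esub> y\<Vert>\<^bsub>F\<^esub> else 0)
       + (if y \<in> carrier F \<and> z \<in> carrier F then \<Vert>y \<ominus>\<^bsub>F\<^esub> z\<Vert>\<^bsub>F\<^esub> else 0)"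
      using A tri by simp
  next
    fix x y assume A: "x \<in> carrier F" "y \<in> carrier F"
    show "((if x \<in> carrier F \<and> y \<in> carrier F then \<Vert>x \<ominus>\<^bsub>F\<^esub> y\<Vert>\<^bsub>F\<^esub> else 0) = 0) = (x = y)"
    proof -
      have "x = (x \<ominus>\<^bsub>F\<^esub> y) \<oplus>\<^bsub>F\<^esub> y" using A by (simp add: a_minus_def M.a_assoc M.l_neg)
      then have "x \<ominus>\<^bsub>F\<^esub> y = \<zero>\<^bsub>F\<^esub> \<longleftrightarrow> x = y"
        using A by (metis M.l_zero M.r_neg a_minus_def)
      then show ?thesis using A pos by simp
    qed
  qed (use comm pos in auto)
qed

lemma banach_linfty: "banach_space (linfty \<Gamma> :: ('k::{real_normed_field, euclidean_space}, 'i \<Rightarrow> 'k) nspace)"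
proof -
  let ?L = "linfty \<Gamma> :: ('k, 'i \<Rightarrow> 'k) nspace"
  have pos: "\<forall>x\<in>carrier ?L. 0 \<le> \<Vert>x\<Vert>\<^bsub>?L\<^esub> \<and> (\<Vert>x\<Vert>\<^bsub>?L\<^esub> = 0 \<longleftrightarrow> x = \<zero>\<^bsub>?L\<^esub>)"
  proof (intro ballI conjI)
    fix x assume x: "x \<in> carrier ?L"
    show "0 \<le> \<Vert>x\<Vert>\<^bsub>?L\<^esub>" by (rule linfty_norm_nonneg[OF x])
    then have "\<Vert>x\<Vert>\<^bsub>?L\<^esub> = 0 \<longleftrightarrow> (\<forall>i\<in>\<Gamma>. norm (x i) \<le> 0)"
      using linfty_norm_le_iff[OF x, of 0] by auto
    also have "\<dots> \<longleftrightarrow> x = \<zero>\<^bsub>?L\<^esub>"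
      using x by (auto simp: fun_eq_iff extensional_def)
    finally show "\<Vert>x\<Vert>\<^bsub>?L\<^esub> = 0 \<longleftrightarrow> x = \<zero>\<^bsub>?L\<^esub>" .
  qed
  have le: "\<Vert>c \<odot>\<^bsub>?L\<^esub> x\<Vert>\<^bsub>?L\<^esub> \<le> norm c * \<Vert>x\<Vert>\<^bsub>?L\<^esub>" if x: "x \<in> carrier ?L" for c x
    using linfty_norm_le_iff[OF linfty_smult_closed[OF x], of "norm c * \<Vert>x\<Vert>\<^bsub>?L\<^esub>" c]
      linfty_norm_ge[OF x] linfty_norm_nonneg[OF x] by (simp add: norm_mult mult_left_mono)
  have hom: "\<forall>c. \<forall>x\<in>carrier ?L. \<Vert>c \<odot>\<^bsub>?L\<^esub> x\<Vert>\<^bsub>?L\<^esub> = norm c * \<Vert>x\<Vert>\<^bsub>?L\<^esub>"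
  proof (intro allI ballI antisym le)
    fix c x assume x: "x \<in> carrier ?L"
    show "norm c * \<Vert>x\<Vert>\<^bsub>?L\<^esub> \<le> \<Vert>c \<odot>\<^bsub>?L\<^esub> x\<Vert>\<^bsub>?L\<^esub>"
    proof (cases "c = 0")
      case True
      then show ?thesis
        using linfty_norm_nonneg[OF linfty_smult_closed[OF x, of 0]] by (simp only: norm_zero mult_zero_left)
    next
      case False
      have "inverse c \<odot>\<^bsub>?L\<^esub> (c \<odot>\<^bsub>?L\<^esub> x) = x"
        using x False by (auto simp: fun_eq_iff extensional_def)
      then have "\<Vert>x\<Vert>\<^bsub>?L\<^esub> \<le> norm (inverse c) * \<Vert>c \<odot>\<^bsub>?L\<^esub> x\<Vert>\<^bsub>?L\<^esub>"
        using le[OF linfty_smult_closed[OF x], of "inverse c" c] by simp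
      then show ?thesis using False by (simp add: norm_inverse norm_divide field_simps)
    qed
  qed
  have tri: "\<forall>x\<in>carrier ?L. \<forall>y\<in>carrier ?L. \<Vert>x \<oplus>\<^bsub>?L\<^esub> y\<Vert>\<^bsub>?L\<^esub> \<le> \<Vert>x\<Vert>\<^bsub>?L\<^esub> + \<Vert>y\<Vert>\<^bsub>?L\<^esub>"
  proof (intro ballI)
    fix x y assume x: "x \<in> carrier ?L" and y: "y \<in> carrier ?L"
    have "norm (x i + y i) \<le> \<Vert>x\<Vert>\<^bsub>?L\<^esub> + \<Vert>y\<Vert>\<^bsub>?L\<^esub>" if "i \<in> \<Gamma>" for i
      using linfty_norm_ge[OF x that] linfty_norm_ge[OF y that] norm_triangle_ineq[of "x i" "y i"] by linarith
    then show "\<Vert>x \<oplus>\<^bsub>?L\<^esub> y\<Vert>\<^bsub>?L\<^esub> \<le> \<Vert>x\<Vert>\<^bsub>?L\<^esub> + \<Vert>y\<Vert>\<^bsub>?L\<^esub>"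
      using linfty_norm_le_iff[OF linfty_add_closed[OF x y]] linfty_norm_nonneg[OF x] linfty_norm_nonneg[OF y]
      by simp
  qed
  let ?d = "\<lambda>x y. if x \<in> carrier ?L \<and> y \<in> carrier ?L then \<Vert>x \<ominus>\<^bsub>?L\<^esub> y\<Vert>\<^bsub>?L\<^esub> else 0"
  interpret M: Metric_space "carrier ?L" ?d
    by (rule Metric_space_nmetric[OF module_linfty pos hom tri])
  interpret V: Module.module "scalar_space :: ('k, 'k) nspace" ?L by (rule module_linfty)
  have d_le: "?d x y \<le> C \<longleftrightarrow> (\<forall>i\<in>\<Gamma>. dist (x i) (y i) \<le> C)"
    if "x \<in> carrier ?L" "y \<in> carrier ?L" "0 \<le> C" for x y C
    using linfty_norm_le_iff[OF V.minus_closed[OF that(1,2)] that(3)] that(1,2)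
    unfolding linfty_minus[OF that(1,2)] by (simp add: dist_norm)
  have "M.mcomplete"
    unfolding M.mcomplete_def
  proof (intro allI impI)
    fix \<sigma> assume \<sigma>: "M.MCauchy \<sigma>"
    then have car: "\<sigma> n \<in> carrier ?L" for n unfolding M.MCauchy_def by blast
    have "uniformly_Cauchy_on \<Gamma> \<sigma>"
      unfolding uniformly_Cauchy_on_def
    proof (intro allI impI)
      fix e :: real assume "e > 0"
      then obtain N where N: "\<forall>n n'. N \<le> n \<longrightarrow> N \<le> n' \<longrightarrow> ?d (\<sigma> n) (\<sigma> n') < e / 2"
        using \<sigma> unfolding M.MCauchy_def by (meson half_gt_zero)
      show "\<exists>M. \<forall>x\<in>\<Gamma>. \<forall>m\<ge>M. \<forall>n\<ge>M. dist (\<sigma> m x) (\<sigma> n x) < e"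
      proof (intro exI ballI allI impI)
        fix i m n assume "i \<in> \<Gamma>" "N \<le> m" "N \<le> n"
        then have "?d (\<sigma> m) (\<sigma> n) \<le> e / 2" using N less_imp_le by blast
        then have "dist (\<sigma> m i) (\<sigma> n i) \<le> e / 2"
          using d_le[OF car car, of "e/2" m n] \<open>e > 0\<close> \<open>i \<in> \<Gamma>\<close> by simp
        then show "dist (\<sigma> m i) (\<sigma> n i) < e" using \<open>e > 0\<close> by linarith
      qed
    qed
    then obtain l where l: "uniform_limit \<Gamma> \<sigma> l sequentially"
      using Cauchy_uniformly_convergent unfolding uniformly_convergent_on_def by blast
    let ?l = "restrict l \<Gamma>"
    have ev: "\<exists>N. \<forall>n\<ge>N. \<forall>i\<in>\<Gamma>. dist (\<sigma> n i) (l i) < e" if "e > 0" for e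
      using uniform_limitD[OF l that] by (simp add: eventually_sequentially)
    have lc: "?l \<in> carrier ?L"
    proof -
      obtain N where N: "\<forall>i\<in>\<Gamma>. dist (\<sigma> N i) (l i) < 1" using ev[of 1] by auto
      obtain B where B: "\<forall>i\<in>\<Gamma>. norm (\<sigma> N i) \<le> B" using car[of N] by (auto simp: bounded_iff)
      have "norm (l i) \<le> B + 1" if "i \<in> \<Gamma>" for i
      proof -
        have "norm (\<sigma> N i) \<le> B" "dist (\<sigma> N i) (l i) < 1" using N B that by auto
        then show ?thesis using norm_triangle_sub[of "l i" "\<sigma> N i"] by (simp add: dist_norm norm_minus_commute)
      qed
      then show ?thesis by (auto simp: bounded_iff)
    qed
    have "\<exists>N. \<forall>n\<ge>N. \<sigma> n \<in> carrier ?L \<and> ?d (\<sigma> n) ?l < e" if "e > 0" for e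
    proof -
      obtain N where N: "\<forall>n\<ge>N. \<forall>i\<in>\<Gamma>. dist (\<sigma> n i) (l i) < e / 2" using ev[of "e/2"] \<open>e > 0\<close> half_gt_zero by blast
      have "?d (\<sigma> n) ?l < e" if "n \<ge> N" for n
      proof -
        have "?d (\<sigma> n) ?l \<le> e / 2"
          using N \<open>e > 0\<close> that by (subst d_le[OF car lc]) (auto intro: less_imp_le)
        then show ?thesis using \<open>e > 0\<close> by linarith
      qed
      then show ?thesis using car by blast
    qed
    then have "limitin M.mtopology \<sigma> ?l sequentially"
      unfolding M.limitin_metric eventually_sequentially using lc by blast
    then show "\<exists>x. limitin M.mtopology \<sigma> x sequentially" by blast
  qed
  then have "mcomplete_of (nmetric ?L)" unfolding nmetric_def by (simp only: M.mcomplete_of)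
  with module_linfty pos hom tri show ?thesis unfolding banach_space_def by blast
qed

lemma dual_ball_bound:
  assumes F: "banach_space F" and a: "a \<in> dual_ball F" and x: "x \<in> carrier F"
  shows "norm (a x) \<le> \<Vert>x\<Vert>\<^bsub>F\<^esub>"
proof -
  let ?S = "{C. 0 \<le> C \<and> (\<forall>x\<in>carrier F. norm (a x) \<le> C * \<Vert>x\<Vert>\<^bsub>F\<^esub>)}"
  have nn: "0 \<le> \<Vert>y\<Vert>\<^bsub>F\<^esub>" if "y \<in> carrier F" for y
    using F that by (auto simp: banach_space_def)
  from a obtain C where "\<forall>x\<in>carrier F. norm (a x) \<le> C * \<Vert>x\<Vert>\<^bsub>F\<^esub>"
    by (auto simp: dual_ball_def bounded_ops_def scalar_space_def)
  then have "norm (a y) \<le> max C 0 * \<Vert>y\<Vert>\<^bsub>F\<^esub>" if "y \<in> carrier F" for y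
    using \<open>\<forall>x\<in>carrier F. norm (a x) \<le> C * \<Vert>x\<Vert>\<^bsub>F\<^esub>\<close> that
      mult_right_mono[OF max.cobounded1 nn[OF that], of C 0] order_trans by blast
  then have "max C 0 \<in> ?S" by auto
  moreover have "Inf ?S \<le> 1"
    using a by (simp add: dual_ball_def op_norm_def scalar_space_def)
  ultimately have *: "\<exists>C\<in>?S. C < 1 + e" if "e > 0" for e
    using that by (intro cInf_lessD) (blast, linarith)
  have "norm (a x) \<le> \<Vert>x\<Vert>\<^bsub>F\<^esub> + d" if "d > 0" for d
  proof -
    let ?e = "d / (\<Vert>x\<Vert>\<^bsub>F\<^esub> + 1)"
    have e: "?e > 0" using that nn[OF x] by simp
    then obtain C where C: "C \<in> ?S" "C < 1 + ?e" using * by blast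
    have "norm (a x) \<le> (1 + ?e) * \<Vert>x\<Vert>\<^bsub>F\<^esub>"
    proof -
      have "norm (a x) \<le> C * \<Vert>x\<Vert>\<^bsub>F\<^esub>" using C(1) x by blast
      also have "\<dots> \<le> (1 + ?e) * \<Vert>x\<Vert>\<^bsub>F\<^esub>"
        using C(2) nn[OF x] by (intro mult_right_mono) auto
      finally show ?thesis .
    qed
    also have "\<dots> \<le> \<Vert>x\<Vert>\<^bsub>F\<^esub> + d" using nn[OF x] that by (simp add: field_simps)
    finally show ?thesis .
  qed
  then show ?thesis by (rule field_le_epsilon)
qed

lemma inj_emb_carrier:
  assumes "banach_space F" "x \<in> carrier F"
  shows "inj_emb F x \<in> carrier (inj_space F)"
  using assms dual_ball_bound[OF assms(1) _ assms(2)]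
  by (auto simp: inj_emb_def inj_space_def bounded_iff)

lemma Lip_carrier:
  assumes "banach_space F" "T \<in> Lip X (npointed F)" "x \<in> points X"
  shows "T x \<in> carrier F"
proof -
  have "Metric_space (carrier F)
    (\<lambda>x y. if x \<in> carrier F \<and> y \<in> carrier F then \<Vert>x \<ominus>\<^bsub>F\<^esub> y\<Vert>\<^bsub>F\<^esub> else 0)"
    using assms(1) by (intro Metric_space_nmetric) (auto simp: banach_space_def)
  then show ?thesis
    using assms(2,3) by (auto simp: Lip_def npointed_def nmetric_def Lipschitz_continuous_map_def Metric_space.mspace_metric)
qed

lemma id_Lip: "pointed X \<Longrightarrow> restrict id (points X) \<in> Lip X X"
  by (auto simp: Lip_def pointed_def Lipschitz_continuous_map_def intro: exI[of _ 1])

lemma inj_hull_copy: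
  assumes ideal: "normed_nonlinear_ideal \<AA> \<alpha>" and X: "pointed X" and F: "banach_space F"
    and T: "T \<in> Lip X (npointed F)"
    and H: "banach_space H" "isometric_iso (inj_space F) H \<Phi>"
    and H': "banach_space H'" "isometric_iso (inj_space F) H' \<Psi>"
    and mem: "(\<lambda>x\<in>points X. \<Phi> (inj_emb F (T x))) \<in> \<AA> X H"
  shows "(\<lambda>x\<in>points X. \<Psi> (inj_emb F (T x))) \<in> \<AA> X H'"
proof -
  let ?I = "inj_space F"
  let ?inv = "inv_into (carrier ?I) \<Phi>"
  define B where "B = (\<lambda>y\<in>carrier H. \<Psi> (?inv y))"
  have bij: "bij_betw \<Phi> (carrier ?I) (carrier H)" using H(2) by (simp add: isometric_iso_def)
  have inv_car: "?inv y \<in> carrier ?I" and f_inv: "\<Phi> (?inv y) = y" if "y \<in> carrier H" for y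
    using bij that by (auto simp: bij_betw_def inv_into_into f_inv_into_f)
  have inv_f: "?inv (\<Phi> f) = f" if "f \<in> carrier ?I" for f
    using bij that by (simp add: bij_betw_def)
  have add: "f \<oplus>\<^bsub>?I\<^esub> g \<in> carrier ?I" if "f \<in> carrier ?I" "g \<in> carrier ?I" for f g
    using linfty_add_closed that unfolding inj_space_def by blast
  have smult: "c \<odot>\<^bsub>?I\<^esub> f \<in> carrier ?I" if "f \<in> carrier ?I" for c f
    using linfty_smult_closed that unfolding inj_space_def by blast
  have \<Phi>: "\<Phi> f \<in> carrier H" "\<Phi> (f \<oplus>\<^bsub>?I\<^esub> g) = \<Phi> f \<oplus>\<^bsub>H\<^esub> \<Phi> g" "\<Phi> (c \<odot>\<^bsub>?I\<^esub> f) = c \<odot>\<^bsub>H\<^esub> \<Phi> f"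
      "\<Vert>\<Phi> f\<Vert>\<^bsub>H\<^esub> = \<Vert>f\<Vert>\<^bsub>?I\<^esub>"
    if "f \<in> carrier ?I" "g \<in> carrier ?I" for f g c
    using H(2) that by (auto simp: isometric_iso_def bounded_ops_def)
  have \<Psi>: "\<Psi> f \<in> carrier H'" "\<Psi> (f \<oplus>\<^bsub>?I\<^esub> g) = \<Psi> f \<oplus>\<^bsub>H'\<^esub> \<Psi> g" "\<Psi> (c \<odot>\<^bsub>?I\<^esub> f) = c \<odot>\<^bsub>H'\<^esub> \<Psi> f"
      "\<Vert>\<Psi> f\<Vert>\<^bsub>H'\<^esub> = \<Vert>f\<Vert>\<^bsub>?I\<^esub>"
    if "f \<in> carrier ?I" "g \<in> carrier ?I" for f g c
    using H'(2) that by (auto simp: isometric_iso_def bounded_ops_def)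
  have B: "B (\<Phi> f) = \<Psi> f" if "f \<in> carrier ?I" for f
    using that \<Phi>(1) inv_f by (simp add: B_def)
  have "B \<in> bounded_ops H H'"
    unfolding bounded_ops_def
  proof (intro CollectI conjI ballI allI)
    show "B \<in> carrier H \<rightarrow>\<^sub>E carrier H'" using inv_car \<Psi>(1) by (auto simp: B_def)
    fix x y assume "x \<in> carrier H" "y \<in> carrier H"
    then obtain f g where fg: "x = \<Phi> f" "y = \<Phi> g" "f \<in> carrier ?I" "g \<in> carrier ?I"
      using inv_car[of x] f_inv[of x] inv_car[of y] f_inv[of y] by force
    then show "B (x \<oplus>\<^bsub>H\<^esub> y) = B x \<oplus>\<^bsub>H'\<^esub> B y"
      using \<Phi>(2)[OF fg(3,4)] \<Psi>(2)[OF fg(3,4)] B[OF add[OF fg(3,4)]] B[OF fg(3)] B[OF fg(4)] by simp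
  next
    fix c x assume "x \<in> carrier H"
    then obtain f where f: "x = \<Phi> f" "f \<in> carrier ?I"
      using inv_car[of x] f_inv[of x] by force
    then show "B (c \<odot>\<^bsub>H\<^esub> x) = c \<odot>\<^bsub>H'\<^esub> B x" using \<Phi>(3)[OF f(2,2), of c] \<Psi>(3)[OF f(2,2), of c] B[OF smult[OF f(2), of c]] B[OF f(2)] by simp
  next
    have "\<Vert>B x\<Vert>\<^bsub>H'\<^esub> \<le> 1 * \<Vert>x\<Vert>\<^bsub>H\<^esub>" if x: "x \<in> carrier H" for x
    proof -
      obtain f where "x = \<Phi> f" "f \<in> carrier ?I"
        using x inv_car[of x] f_inv[of x] by force
      then show ?thesis using \<Phi>(4) \<Psi>(4) B by simp
    qed
    then show "\<exists>C. \<forall>x\<in>carrier H. \<Vert>B x\<Vert>\<^bsub>H'\<^esub> \<le> C * \<Vert>x\<Vert>\<^bsub>H\<^esub>" by blast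
  qed
  then have "(\<lambda>x\<in>points X. B ((\<lambda>x\<in>points X. \<Phi> (inj_emb F (T x))) (restrict id (points X) x))) \<in> \<AA> X H'"
    using ideal X H(1) H'(1) mem id_Lip[OF X] unfolding normed_nonlinear_ideal_def by blast
  moreover have "(\<lambda>x\<in>points X. B ((\<lambda>x\<in>points X. \<Phi> (inj_emb F (T x))) (restrict id (points X) x)))
      = (\<lambda>x\<in>points X. \<Psi> (inj_emb F (T x)))"
    using B inj_emb_carrier[OF F] Lip_carrier[OF F T] by (auto simp: restrict_def)
  ultimately show ?thesis by simp
qed

lemma inj_hull_iff:
  fixes F :: "('k::{real_normed_field, euclidean_space}, 'v) nspace"
    and \<AA> :: "('m, 'k, ('v \<Rightarrow> 'k) \<Rightarrow> 'k) components"
  assumes ideal: "normed_nonlinear_ideal \<AA> \<alpha>" and X: "pointed X" and F: "banach_space F"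
  shows "T \<in> inj_hull \<AA> X F \<longleftrightarrow>
    T \<in> Lip X (npointed F) \<and> (\<lambda>x\<in>points X. inj_emb F (T x)) \<in> \<AA> X (inj_space F)"
proof -
  let ?I = "inj_space F"
  let ?id = "restrict id (carrier ?I)"
  have I: "banach_space ?I" unfolding inj_space_def by (rule banach_linfty)
  have "f \<oplus>\<^bsub>?I\<^esub> g \<in> carrier ?I" if "f \<in> carrier ?I" "g \<in> carrier ?I" for f g
    using linfty_add_closed that unfolding inj_space_def by blast
  moreover have "c \<odot>\<^bsub>?I\<^esub> f \<in> carrier ?I" if "f \<in> carrier ?I" for c f
    using linfty_smult_closed that unfolding inj_space_def by blast
  ultimately have "?id \<in> bounded_ops ?I ?I"
    unfolding bounded_ops_def
  proof (intro CollectI conjI ballI allI)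
    show "\<exists>C. \<forall>x\<in>carrier ?I. \<Vert>?id x\<Vert>\<^bsub>?I\<^esub> \<le> C * \<Vert>x\<Vert>\<^bsub>?I\<^esub>"
      by (intro exI[of _ 1]) simp
  qed simp_all
  then have id: "isometric_iso ?I ?I ?id"
    by (auto simp: isometric_iso_def bij_betw_def inj_on_def)
  have eq: "(\<lambda>x\<in>points X. ?id (inj_emb F (T x))) = (\<lambda>x\<in>points X. inj_emb F (T x))"
    if "T \<in> Lip X (npointed F)"
    using inj_emb_carrier[OF F] Lip_carrier[OF F that] by (auto simp: restrict_def)
  show ?thesis
  proof
    assume "T \<in> inj_hull \<AA> X F"
    then obtain H \<Phi> where T: "T \<in> Lip X (npointed F)" and H: "banach_space H"
      "isometric_iso ?I H \<Phi>" "(\<lambda>x\<in>points X. \<Phi> (inj_emb F (T x))) \<in> \<AA> X H"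
      unfolding inj_hull_def by blast
    show "T \<in> Lip X (npointed F) \<and> (\<lambda>x\<in>points X. inj_emb F (T x)) \<in> \<AA> X ?I"
      using T inj_hull_copy[OF ideal X F T H(1,2) I id H(3)] by (simp only: eq[OF T])
  next
    assume *: "T \<in> Lip X (npointed F) \<and> (\<lambda>x\<in>points X. inj_emb F (T x)) \<in> \<AA> X ?I"
    then show "T \<in> inj_hull \<AA> X F"
      unfolding inj_hull_def using I id eq
      by (intro CollectI conjI exI[of _ ?I] exI[of _ ?id]) (simp_all only:)
  qed
qed


lemma a_minus_scalar_space:
  "x \<ominus>\<^bsub>(scalar_space :: ('k::{real_normed_field, euclidean_space}, 'k) nspace)\<^esub> y = x - y"
proof -
  interpret cring "scalar_space :: ('k, 'k) nspace" by (rule cring_scalar_space)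
  have "\<ominus>\<^bsub>(scalar_space :: ('k, 'k) nspace)\<^esub> y = - y"
    by (rule minus_equality) (simp_all add: scalar_space_def)
  then show ?thesis by (simp add: a_minus_def) (simp add: scalar_space_def)
qed

lemma nmetric_scalar_space:
  "nmetric (scalar_space :: ('k::{real_normed_field, euclidean_space}, 'k) nspace) = euclidean_metric"
  unfolding nmetric_def euclidean_metric_def a_minus_scalar_space
  by (rule arg_cong[of _ _ metric]) (simp add: scalar_space_def fun_eq_iff dist_norm)

end

theory Submission
  imports Defs
begin

text \<open>
  Let \<open>S\<close> be a map that dominates \<open>T\<close> in the sense of the interpolation, and in the third inclusion
  let \<open>R\<close> dominate \<open>S\<close>. Write \<open>s = \<parallel>Sx - Sy\<parallel>\<close>, \<open>r = \<parallel>Rx - Ry\<parallel>\<close> and \<open>d = d(x, y)\<close>. The third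
  inclusion is a computation with exponents: inserting
  \<open>s \<le> r\<^bsup>1-\<theta>\<^sub>1\<^esup> d\<^bsup>\<theta>\<^sub>1\<^esup>\<close> into \<open>\<parallel>Tx - Ty\<parallel> \<le> s\<^bsup>1-\<theta>\<^sub>2\<^esup> d\<^bsup>\<theta>\<^sub>2\<^esup>\<close>
  multiplies the parameters \<open>1 - \<theta>\<^sub>i\<close> (\<open>interp_interp\<close>).

  For the first inclusion, \<open>S\<close> is Lipschitz, so part of the power of \<open>s\<close> can be traded for the
  same power of \<open>d\<close>, at the price of a constant; the constant is absorbed into \<open>S\<close>, since an ideal
  is closed under scalar multiples (\<open>interp_mono\<close>).

  The second inclusion follows from the first one once it is known for \<open>\<theta> = 0\<close>, and there \<open>J\<^sub>F T\<close>,
  read in an isometric copy of its target, serves as \<open>S\<close>, because \<open>J\<^sub>F\<close> does not decrease distances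
  (\<open>norm_diff_le_inj_emb\<close>). This is the Hahn--Banach theorem: every vector is normed by a functional in the dual ball
  (\<open>norming_functional\<close>). A real functional is found as a minimal element among the sublinear
  functionals below the norm, since a minimal sublinear functional is additive. It is then turned
  into a functional with values in the scalar field \<open>K\<close>. This step needs no case distinction between
  real and complex scalars: the bilinear form \<open>(l, k) \<mapsto> (l k) \<bullet> 1\<close> on \<open>K\<close> is nondegenerate,
  because \<open>k\<^bsup>-1\<^esup> k = 1\<close>, and represents all real functionals on the finite-dimensional space \<open>K\<close>.
\<close>

section \<open>Banach spaces on carriers\<close>

locale banach_carrier =
  fixes F :: "('k::{real_normed_field, euclidean_space}, 'v) nspace"
  assumes banach: "banach_space F"
begin

sublocale Module.module "scalar_space :: ('k, 'k) nspace" F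
  using banach by (simp add: banach_space_def)

lemma scalar_simps [simp]:
  "carrier (scalar_space :: ('k, 'k) nspace) = UNIV"
  "\<one>\<^bsub>(scalar_space :: ('k, 'k) nspace)\<^esub> = 1"
  "\<zero>\<^bsub>(scalar_space :: ('k, 'k) nspace)\<^esub> = 0"
  "c \<oplus>\<^bsub>(scalar_space :: ('k, 'k) nspace)\<^esub> d = c + d"
  "c \<otimes>\<^bsub>(scalar_space :: ('k, 'k) nspace)\<^esub> d = c * d"
  by (simp_all add: scalar_space_def)

lemma scale_closed [simp]: "x \<in> carrier F \<Longrightarrow> c \<odot>\<^bsub>F\<^esub> x \<in> carrier F"
  using smult_closed[of c x] by simp

lemma scale_add_left: "x \<in> carrier F \<Longrightarrow> (c + d) \<odot>\<^bsub>F\<^esub> x = c \<odot>\<^bsub>F\<^esub> x \<oplus>\<^bsub>F\<^esub> d \<odot>\<^bsub>F\<^esub> x"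
  using smult_l_distr[of c d x] by simp

lemma scale_add_right:
  "x \<in> carrier F \<Longrightarrow> y \<in> carrier F \<Longrightarrow> c \<odot>\<^bsub>F\<^esub> (x \<oplus>\<^bsub>F\<^esub> y) = c \<odot>\<^bsub>F\<^esub> x \<oplus>\<^bsub>F\<^esub> c \<odot>\<^bsub>F\<^esub> y"
  using smult_r_distr[of c x y] by simp

lemma scale_scale: "x \<in> carrier F \<Longrightarrow> c \<odot>\<^bsub>F\<^esub> (d \<odot>\<^bsub>F\<^esub> x) = (c * d) \<odot>\<^bsub>F\<^esub> x"
  using smult_assoc1[of c d x] by simp

lemma scale_one [simp]: "x \<in> carrier F \<Longrightarrow> 1 \<odot>\<^bsub>F\<^esub> x = x"
  using smult_one[of x] by simp

lemma scale_zero [simp]: "x \<in> carrier F \<Longrightarrow> 0 \<odot>\<^bsub>F\<^esub> x = \<zero>\<^bsub>F\<^esub>"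
  using smult_l_null[of x] by simp

lemma add_scale_minus_one: "x \<in> carrier F \<Longrightarrow> x \<oplus>\<^bsub>F\<^esub> (-1) \<odot>\<^bsub>F\<^esub> x = \<zero>\<^bsub>F\<^esub>"
  using scale_add_left[of x 1 "-1"] by simp

lemma minus_conv_scale:
  assumes "x \<in> carrier F" "y \<in> carrier F"
  shows "x \<ominus>\<^bsub>F\<^esub> y = x \<oplus>\<^bsub>F\<^esub> (-1) \<odot>\<^bsub>F\<^esub> y"
proof -
  have "\<ominus>\<^bsub>F\<^esub> y = (-1) \<odot>\<^bsub>F\<^esub> y"
    using assms add_scale_minus_one[of y] M.a_comm[of y "(-1) \<odot>\<^bsub>F\<^esub> y"]
    by (intro M.minus_equality) auto
  then show ?thesis by (simp add: a_minus_def)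
qed

lemma scale_minus:
  assumes "x \<in> carrier F" "y \<in> carrier F"
  shows "c \<odot>\<^bsub>F\<^esub> x \<ominus>\<^bsub>F\<^esub> c \<odot>\<^bsub>F\<^esub> y = c \<odot>\<^bsub>F\<^esub> (x \<ominus>\<^bsub>F\<^esub> y)"
  using assms by (simp add: minus_conv_scale scale_add_right scale_scale)

lemma norm_nonneg: "x \<in> carrier F \<Longrightarrow> 0 \<le> \<Vert>x\<Vert>\<^bsub>F\<^esub>"
  using banach by (simp add: banach_space_def)

lemma norm_scale: "x \<in> carrier F \<Longrightarrow> \<Vert>c \<odot>\<^bsub>F\<^esub> x\<Vert>\<^bsub>F\<^esub> = norm c * \<Vert>x\<Vert>\<^bsub>F\<^esub>"
  using banach by (simp add: banach_space_def)

lemma norm_add: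
  "x \<in> carrier F \<Longrightarrow> y \<in> carrier F \<Longrightarrow> \<Vert>x \<oplus>\<^bsub>F\<^esub> y\<Vert>\<^bsub>F\<^esub> \<le> \<Vert>x\<Vert>\<^bsub>F\<^esub> + \<Vert>y\<Vert>\<^bsub>F\<^esub>"
  using banach by (simp add: banach_space_def)

lemma mdist_nmetric:
  assumes "x \<in> carrier F" "y \<in> carrier F"
  shows "mdist (nmetric F) x y = \<Vert>x \<ominus>\<^bsub>F\<^esub> y\<Vert>\<^bsub>F\<^esub>"
proof -
  have "Metric_space (carrier F)
    (\<lambda>x y. if x \<in> carrier F \<and> y \<in> carrier F then \<Vert>x \<ominus>\<^bsub>F\<^esub> y\<Vert>\<^bsub>F\<^esub> else 0)"
    using banach by (intro Metric_space_nmetric) (auto simp: banach_space_def)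
  then show ?thesis
    using assms by (simp add: nmetric_def Metric_space.mdist_metric)
qed

section \<open>The Hahn--Banach theorem\<close>

definition sublinear :: "('v \<Rightarrow> real) \<Rightarrow> bool"
  where "sublinear q \<longleftrightarrow>
     (\<forall>x\<in>carrier F. \<forall>y\<in>carrier F. q (x \<oplus>\<^bsub>F\<^esub> y) \<le> q x + q y) \<and>
     (\<forall>t\<ge>0. \<forall>x\<in>carrier F. q (of_real t \<odot>\<^bsub>F\<^esub> x) \<le> t * q x)"

lemma sublinear_add:
  "sublinear q \<Longrightarrow> x \<in> carrier F \<Longrightarrow> y \<in> carrier F \<Longrightarrow> q (x \<oplus>\<^bsub>F\<^esub> y) \<le> q x + q y"
  by (simp add: sublinear_def)

lemma sublinear_zero:
  assumes "sublinear q"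
  shows "q \<zero>\<^bsub>F\<^esub> = 0"
proof -
  have "q (of_real 0 \<odot>\<^bsub>F\<^esub> \<zero>\<^bsub>F\<^esub>) \<le> 0 * q \<zero>\<^bsub>F\<^esub>"
    using assms unfolding sublinear_def by blast
  moreover have "q (\<zero>\<^bsub>F\<^esub> \<oplus>\<^bsub>F\<^esub> \<zero>\<^bsub>F\<^esub>) \<le> q \<zero>\<^bsub>F\<^esub> + q \<zero>\<^bsub>F\<^esub>"
    using assms by (intro sublinear_add) auto
  ultimately show ?thesis by simp
qed

lemma sublinear_scale:
  assumes q: "sublinear q" and t: "0 \<le> t" and x: "x \<in> carrier F"
  shows "q (of_real t \<odot>\<^bsub>F\<^esub> x) = t * q x"
proof (cases "t = 0")
  case True
  then show ?thesis using sublinear_zero[OF q] x by simp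
next
  case False
  have "q (of_real (1 / t) \<odot>\<^bsub>F\<^esub> (of_real t \<odot>\<^bsub>F\<^esub> x)) \<le> (1 / t) * q (of_real t \<odot>\<^bsub>F\<^esub> x)"
    using q t x unfolding sublinear_def by (meson divide_nonneg_nonneg scale_closed zero_le_one)
  moreover have "of_real (1 / t) \<odot>\<^bsub>F\<^esub> (of_real t \<odot>\<^bsub>F\<^esub> x) = x"
    using False x by (simp add: scale_scale)
  ultimately have "t * q x \<le> q (of_real t \<odot>\<^bsub>F\<^esub> x)"
    using False t by (simp add: field_simps)
  moreover have "q (of_real t \<odot>\<^bsub>F\<^esub> x) \<le> t * q x"
    using q t x unfolding sublinear_def by blast
  ultimately show ?thesis by linarith
qed

lemma sublinear_lower:
  assumes "sublinear q" "x \<in> carrier F"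
  shows "- q ((-1) \<odot>\<^bsub>F\<^esub> x) \<le> q x"
  using sublinear_add[OF assms(1,2), of "(-1) \<odot>\<^bsub>F\<^esub> x"] assms
  by (simp add: add_scale_minus_one sublinear_zero)

lemma sublinear_norm: "sublinear (nrm F)"
  unfolding sublinear_def by (simp add: norm_add norm_scale)

text \<open>This is the largest sublinear functional below \<open>q\<close> that takes a value of at most \<open>- q y\<close> at
  \<open>- y\<close>, and hence is linear along \<open>y\<close>.\<close>

definition tilt :: "'v \<Rightarrow> ('v \<Rightarrow> real) \<Rightarrow> 'v \<Rightarrow> real"
  where "tilt y q x = (if x \<in> carrier F
     then INF t\<in>{0..}. q (x \<oplus>\<^bsub>F\<^esub> of_real t \<odot>\<^bsub>F\<^esub> y) - t * q y else 0)"

text \<open>The infimum is over a set bounded below: \<open>t q y = q (t y) \<le> q (x + t y) + q (- x)\<close>.\<close>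

lemma tilt_le:
  assumes q: "sublinear q" and y: "y \<in> carrier F" and x: "x \<in> carrier F" and t: "0 \<le> t"
  shows "tilt y q x \<le> q (x \<oplus>\<^bsub>F\<^esub> of_real t \<odot>\<^bsub>F\<^esub> y) - t * q y"
proof -
  have "- q ((-1) \<odot>\<^bsub>F\<^esub> x) \<le> q (x \<oplus>\<^bsub>F\<^esub> of_real s \<odot>\<^bsub>F\<^esub> y) - s * q y" if s: "0 \<le> s" for s
  proof -
    let ?z = "of_real s \<odot>\<^bsub>F\<^esub> y"
    have "(x \<oplus>\<^bsub>F\<^esub> ?z) \<oplus>\<^bsub>F\<^esub> (-1) \<odot>\<^bsub>F\<^esub> x = (x \<oplus>\<^bsub>F\<^esub> (-1) \<odot>\<^bsub>F\<^esub> x) \<oplus>\<^bsub>F\<^esub> ?z"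
      using x y by (simp add: M.a_ac)
    then have "(x \<oplus>\<^bsub>F\<^esub> ?z) \<oplus>\<^bsub>F\<^esub> (-1) \<odot>\<^bsub>F\<^esub> x = ?z"
      using x y by (simp add: add_scale_minus_one)
    then have "q ?z \<le> q (x \<oplus>\<^bsub>F\<^esub> ?z) + q ((-1) \<odot>\<^bsub>F\<^esub> x)"
      using sublinear_add[OF q, of "x \<oplus>\<^bsub>F\<^esub> ?z" "(-1) \<odot>\<^bsub>F\<^esub> x"] x y by simp
    then show ?thesis using sublinear_scale[OF q s y] by simp
  qed
  then have "bdd_below ((\<lambda>t. q (x \<oplus>\<^bsub>F\<^esub> of_real t \<odot>\<^bsub>F\<^esub> y) - t * q y) ` {0..})"
    by (intro bdd_belowI2[where m = "- q ((-1) \<odot>\<^bsub>F\<^esub> x)"]) simp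
  then show ?thesis using x t by (auto simp: tilt_def intro!: cINF_lower)
qed

lemma tilt_greatest:
  assumes "x \<in> carrier F" "\<And>t. 0 \<le> t \<Longrightarrow> B \<le> q (x \<oplus>\<^bsub>F\<^esub> of_real t \<odot>\<^bsub>F\<^esub> y) - t * q y"
  shows "B \<le> tilt y q x"
  using assms by (auto simp: tilt_def intro!: cINF_greatest)

lemma tilt_le_self:
  assumes "sublinear q" "y \<in> carrier F" "x \<in> carrier F"
  shows "tilt y q x \<le> q x"
  using tilt_le[OF assms, of 0] assms by simp

lemma sublinear_tilt:
  assumes q: "sublinear q" and y: "y \<in> carrier F"
  shows "sublinear (tilt y q)"
  unfolding sublinear_def
proof (intro conjI ballI allI impI)
  fix x z assume x: "x \<in> carrier F" and z: "z \<in> carrier F"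
  have *: "tilt y q (x \<oplus>\<^bsub>F\<^esub> z) \<le> (q (x \<oplus>\<^bsub>F\<^esub> of_real s \<odot>\<^bsub>F\<^esub> y) - s * q y)
      + (q (z \<oplus>\<^bsub>F\<^esub> of_real t \<odot>\<^bsub>F\<^esub> y) - t * q y)" if "0 \<le> s" "0 \<le> t" for s t
  proof -
    have "(x \<oplus>\<^bsub>F\<^esub> z) \<oplus>\<^bsub>F\<^esub> of_real (s + t) \<odot>\<^bsub>F\<^esub> y
        = (x \<oplus>\<^bsub>F\<^esub> of_real s \<odot>\<^bsub>F\<^esub> y) \<oplus>\<^bsub>F\<^esub> (z \<oplus>\<^bsub>F\<^esub> of_real t \<odot>\<^bsub>F\<^esub> y)"
      using x y z by (simp add: scale_add_left M.a_ac)
    then show ?thesis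
      using tilt_le[OF q y, of "x \<oplus>\<^bsub>F\<^esub> z" "s + t"] that x y z
        sublinear_add[OF q, of "x \<oplus>\<^bsub>F\<^esub> of_real s \<odot>\<^bsub>F\<^esub> y" "z \<oplus>\<^bsub>F\<^esub> of_real t \<odot>\<^bsub>F\<^esub> y"]
      by (simp add: algebra_simps)
  qed
  have "tilt y q (x \<oplus>\<^bsub>F\<^esub> z) - tilt y q z \<le> tilt y q x"
  proof (rule tilt_greatest[OF x])
    fix s :: real assume s: "0 \<le> s"
    have "tilt y q (x \<oplus>\<^bsub>F\<^esub> z) - (q (x \<oplus>\<^bsub>F\<^esub> of_real s \<odot>\<^bsub>F\<^esub> y) - s * q y) \<le> tilt y q z"
      using *[OF s] by (intro tilt_greatest[OF z]) (simp add: algebra_simps)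
    then show "tilt y q (x \<oplus>\<^bsub>F\<^esub> z) - tilt y q z \<le> q (x \<oplus>\<^bsub>F\<^esub> of_real s \<odot>\<^bsub>F\<^esub> y) - s * q y"
      by linarith
  qed
  then show "tilt y q (x \<oplus>\<^bsub>F\<^esub> z) \<le> tilt y q x + tilt y q z" by linarith
next
  fix c :: real and x assume c: "0 \<le> c" and x: "x \<in> carrier F"
  show "tilt y q (of_real c \<odot>\<^bsub>F\<^esub> x) \<le> c * tilt y q x"
  proof (cases "c = 0")
    case True
    then show ?thesis using tilt_le_self[OF q y, of "\<zero>\<^bsub>F\<^esub>"] sublinear_zero[OF q] x by simp
  next
    case False
    have "tilt y q (of_real c \<odot>\<^bsub>F\<^esub> x) / c \<le> tilt y q x"
    proof (rule tilt_greatest[OF x])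
      fix t :: real assume t: "0 \<le> t"
      have "of_real c \<odot>\<^bsub>F\<^esub> (x \<oplus>\<^bsub>F\<^esub> of_real t \<odot>\<^bsub>F\<^esub> y)
          = of_real c \<odot>\<^bsub>F\<^esub> x \<oplus>\<^bsub>F\<^esub> of_real (c * t) \<odot>\<^bsub>F\<^esub> y"
        using x y by (simp add: scale_add_right scale_scale)
      then have "tilt y q (of_real c \<odot>\<^bsub>F\<^esub> x) \<le> c * (q (x \<oplus>\<^bsub>F\<^esub> of_real t \<odot>\<^bsub>F\<^esub> y) - t * q y)"
        using tilt_le[OF q y, of "of_real c \<odot>\<^bsub>F\<^esub> x" "c * t"] c t x y
          sublinear_scale[OF q c, of "x \<oplus>\<^bsub>F\<^esub> of_real t \<odot>\<^bsub>F\<^esub> y"]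
        by (simp add: algebra_simps)
      then show "tilt y q (of_real c \<odot>\<^bsub>F\<^esub> x) / c \<le> q (x \<oplus>\<^bsub>F\<^esub> of_real t \<odot>\<^bsub>F\<^esub> y) - t * q y"
        using c False by (simp add: field_simps)
    qed
    then show ?thesis using c False by (simp add: field_simps)
  qed
qed

text \<open>On a chain the infimum stays subadditive, as \<open>q x + r y\<close> is at least \<open>s x + s y\<close> for the smaller
  one \<open>s\<close> of \<open>q\<close> and \<open>r\<close>. The common bound \<open>p\<close> ensures that the infimum exists, by
  \<open>q x \<ge> - q (- x) \<ge> - p (- x)\<close>.\<close>

lemma sublinear_INF:
  assumes ne: "C \<noteq> {}" and sub: "\<And>q. q \<in> C \<Longrightarrow> sublinear q"
    and le: "\<And>q x. q \<in> C \<Longrightarrow> x \<in> carrier F \<Longrightarrow> q x \<le> p x"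
    and chain: "\<And>q r. q \<in> C \<Longrightarrow> r \<in> C \<Longrightarrow> q \<le> r \<or> r \<le> q"
  defines "u \<equiv> \<lambda>x. if x \<in> carrier F then INF q\<in>C. q x else 0"
  shows "sublinear u" "\<And>q x. q \<in> C \<Longrightarrow> x \<in> carrier F \<Longrightarrow> u x \<le> q x"
proof -
  show lower: "u x \<le> q x" if "q \<in> C" "x \<in> carrier F" for q x
  proof -
    have "- p ((-1) \<odot>\<^bsub>F\<^esub> x) \<le> r x" if "r \<in> C" for r
      using sublinear_lower[OF sub[OF that] \<open>x \<in> carrier F\<close>]
        le[OF that scale_closed[OF \<open>x \<in> carrier F\<close>], of "-1"] by linarith
    then have "bdd_below ((\<lambda>q. q x) ` C)"
      by (intro bdd_belowI2)
    then show ?thesis using that by (auto simp: u_def intro!: cINF_lower)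
  qed
  have greatest: "B \<le> u x" if "x \<in> carrier F" "\<And>q. q \<in> C \<Longrightarrow> B \<le> q x" for B x
    using that ne by (auto simp: u_def intro!: cINF_greatest)
  show "sublinear u"
    unfolding sublinear_def
  proof (intro conjI ballI allI impI)
    fix x y assume x: "x \<in> carrier F" and y: "y \<in> carrier F"
    have *: "u (x \<oplus>\<^bsub>F\<^esub> y) \<le> q x + r y" if qr: "q \<in> C" "r \<in> C" for q r
    proof -
      obtain s where s: "s \<in> C" "s \<le> q" "s \<le> r" using chain[OF qr] qr by blast
      have "u (x \<oplus>\<^bsub>F\<^esub> y) \<le> s (x \<oplus>\<^bsub>F\<^esub> y)" using lower s x y by simp
      also have "\<dots> \<le> s x + s y" using sublinear_add sub s x y by blast
      also have "\<dots> \<le> q x + r y" using s by (intro add_mono) (auto simp: le_fun_def)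
      finally show ?thesis .
    qed
    have "u (x \<oplus>\<^bsub>F\<^esub> y) - u y \<le> u x"
    proof (rule greatest[OF x])
      fix q assume q: "q \<in> C"
      have "u (x \<oplus>\<^bsub>F\<^esub> y) - q x \<le> u y"
        using *[OF q] by (intro greatest[OF y]) (simp add: algebra_simps)
      then show "u (x \<oplus>\<^bsub>F\<^esub> y) - u y \<le> q x" by linarith
    qed
    then show "u (x \<oplus>\<^bsub>F\<^esub> y) \<le> u x + u y" by linarith
  next
    fix t :: real and x assume t: "0 \<le> t" and x: "x \<in> carrier F"
    show "u (of_real t \<odot>\<^bsub>F\<^esub> x) \<le> t * u x"
    proof (cases "t = 0")
      case True
      obtain q where "q \<in> C" using ne by blast
      then show ?thesis using True lower[of q "\<zero>\<^bsub>F\<^esub>"] sublinear_zero[OF sub, of q] x by simp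
    next
      case False
      have "u (of_real t \<odot>\<^bsub>F\<^esub> x) / t \<le> u x"
      proof (rule greatest[OF x])
        fix q assume q: "q \<in> C"
        show "u (of_real t \<odot>\<^bsub>F\<^esub> x) / t \<le> q x"
          using lower[OF q, of "of_real t \<odot>\<^bsub>F\<^esub> x"] sublinear_scale[OF sub[OF q] t x] t x False
          by (simp add: field_simps)
      qed
      then show ?thesis using t False by (simp add: field_simps)
    qed
  qed
qed

definition real_linear :: "('v \<Rightarrow> real) \<Rightarrow> bool"
  where "real_linear f \<longleftrightarrow>
     (\<forall>x\<in>carrier F. \<forall>y\<in>carrier F. f (x \<oplus>\<^bsub>F\<^esub> y) = f x + f y) \<and>
     (\<forall>t. \<forall>x\<in>carrier F. f (of_real t \<odot>\<^bsub>F\<^esub> x) = t * f x)"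

text \<open>Zorn's lemma yields a minimal sublinear functional \<open>f\<close> below \<open>p\<close>. By minimality \<open>f\<close> agrees with
  its tilt along every \<open>y\<close>, so \<open>f x \<le> f (x + y) - f y\<close>, the inequality opposite to subadditivity.\<close>

lemma real_functional_below_sublinear:
  assumes p: "sublinear p"
  shows "\<exists>f. real_linear f \<and> (\<forall>x\<in>carrier F. f x \<le> p x)"
proof -
  \<comment> \<open>The value \<open>0\<close> off the carrier makes the pointwise order antisymmetric.\<close>
  define A where "A = {q. sublinear q \<and> (\<forall>x\<in>carrier F. q x \<le> p x) \<and> (\<forall>x. x \<notin> carrier F \<longrightarrow> q x = 0)}"
  let ?P = "\<lambda>q r :: 'v \<Rightarrow> real. r \<le> q"
  have "\<exists>f\<in>A. \<forall>q\<in>A. ?P f q \<longrightarrow> q = f"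
  proof (rule predicate_Zorn)
    show "partial_order_on A (relation_of ?P A)"
      by (rule partial_order_on_relation_ofI) auto
    fix C assume C: "C \<in> Chains (relation_of ?P A)"
    then have CA: "C \<subseteq> A" and chain: "\<And>q r. q \<in> C \<Longrightarrow> r \<in> C \<Longrightarrow> q \<le> r \<or> r \<le> q"
      by (auto simp: Chains_def relation_of_def)
    show "\<exists>u\<in>A. \<forall>q\<in>C. ?P q u"
    proof (cases "C = {}")
      case True
      have "(\<lambda>x. if x \<in> carrier F then p x else 0) \<in> A"
        using p by (simp add: A_def sublinear_def)
      then show ?thesis using True by blast
    next
      case False
      let ?u = "\<lambda>x. if x \<in> carrier F then INF q\<in>C. q x else 0"
      have C': "\<And>q. q \<in> C \<Longrightarrow> sublinear q" "\<And>q x. q \<in> C \<Longrightarrow> x \<in> carrier F \<Longrightarrow> q x \<le> p x"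
        "\<And>q x. q \<in> C \<Longrightarrow> x \<notin> carrier F \<Longrightarrow> q x = 0"
        using CA by (auto simp: A_def)
      have u_sub: "sublinear ?u"
        by (rule sublinear_INF(1)[where p = p]; use False C' chain in blast)
      have u_le: "?u x \<le> q x" if "q \<in> C" "x \<in> carrier F" for q x
        by (rule sublinear_INF(2)[where p = p]; use False C' chain that in blast)
      have "?u \<in> A"
        unfolding A_def mem_Collect_eq
      proof (intro conjI u_sub ballI allI impI)
        fix x assume x: "x \<in> carrier F"
        obtain q where q: "q \<in> C" using False by blast
        show "?u x \<le> p x" using u_le[OF q x] C'(2)[OF q x] by (rule order_trans)
      qed simp_all
      moreover have "\<forall>q\<in>C. ?u \<le> q"
      proof (intro ballI le_funI)
        fix q x assume q: "q \<in> C"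
        show "?u x \<le> q x"
        proof (cases "x \<in> carrier F")
          case True
          show ?thesis using u_le[OF q True] .
        qed (simp add: C'(3)[OF q])
      qed
      ultimately show ?thesis by blast
    qed
  qed
  then obtain f where f: "f \<in> A" and min: "\<And>q. q \<in> A \<Longrightarrow> q \<le> f \<Longrightarrow> q = f" by blast
  have sub: "sublinear f" and fp: "\<And>x. x \<in> carrier F \<Longrightarrow> f x \<le> p x"
    using f by (auto simp: A_def)
  have add: "f (x \<oplus>\<^bsub>F\<^esub> y) = f x + f y" if x: "x \<in> carrier F" and y: "y \<in> carrier F" for x y
  proof -
    have "tilt y f \<le> f"
    proof (rule le_funI)
      fix z show "tilt y f z \<le> f z"
        using tilt_le_self[OF sub y] f by (cases "z \<in> carrier F") (auto simp: A_def tilt_def)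
    qed
    moreover have "tilt y f \<in> A"
      using sublinear_tilt[OF sub y] tilt_le_self[OF sub y] fp unfolding A_def
      by (auto simp: tilt_def intro: order_trans)
    ultimately have "tilt y f = f" using min by blast
    then have "f x \<le> f (x \<oplus>\<^bsub>F\<^esub> y) - f y" using tilt_le[OF sub y x, of 1] y by simp
    then show ?thesis using sublinear_add[OF sub x y] by linarith
  qed
  have neg: "f ((-1) \<odot>\<^bsub>F\<^esub> x) = - f x" if "x \<in> carrier F" for x
    using add[OF that scale_closed[OF that], of "-1"] sublinear_zero[OF sub] add_scale_minus_one[OF that]
    by simp
  have "f (of_real t \<odot>\<^bsub>F\<^esub> x) = t * f x" if x: "x \<in> carrier F" for t x
  proof (cases "0 \<le> t")
    case False
    have "of_real t \<odot>\<^bsub>F\<^esub> x = (-1) \<odot>\<^bsub>F\<^esub> (of_real (- t) \<odot>\<^bsub>F\<^esub> x)" using x by (simp add: scale_scale)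
    then show ?thesis using False neg[of "of_real (- t) \<odot>\<^bsub>F\<^esub> x"] sublinear_scale[OF sub, of "- t"] x by simp
  qed (simp add: sublinear_scale[OF sub] x)
  with add fp show ?thesis unfolding real_linear_def by blast
qed

text \<open>A linear functional below the tilt of the norm along \<open>z\<close> is at most \<open>- \<parallel>z\<parallel>\<close> at \<open>- z\<close>, hence
  at least \<open>\<parallel>z\<parallel>\<close> at \<open>z\<close>.\<close>

lemma norming_real_functional:
  assumes z: "z \<in> carrier F"
  shows "\<exists>f. real_linear f \<and> (\<forall>x\<in>carrier F. f x \<le> \<Vert>x\<Vert>\<^bsub>F\<^esub>) \<and> f z = \<Vert>z\<Vert>\<^bsub>F\<^esub>"
proof -
  obtain f where f: "real_linear f" and ft: "\<And>x. x \<in> carrier F \<Longrightarrow> f x \<le> tilt z (nrm F) x"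
    using real_functional_below_sublinear[OF sublinear_tilt[OF sublinear_norm z]] by blast
  have le: "f x \<le> \<Vert>x\<Vert>\<^bsub>F\<^esub>" if "x \<in> carrier F" for x
    using ft[OF that] tilt_le_self[OF sublinear_norm z that] by linarith
  have "(-1) \<odot>\<^bsub>F\<^esub> z \<oplus>\<^bsub>F\<^esub> z = \<zero>\<^bsub>F\<^esub>" using z add_scale_minus_one[OF z] by (simp add: M.a_comm)
  then have "tilt z (nrm F) ((-1) \<odot>\<^bsub>F\<^esub> z) \<le> - \<Vert>z\<Vert>\<^bsub>F\<^esub>"
    using tilt_le[OF sublinear_norm z, of "(-1) \<odot>\<^bsub>F\<^esub> z" 1] sublinear_zero[OF sublinear_norm] z by simp
  then have "f ((-1) \<odot>\<^bsub>F\<^esub> z) \<le> - \<Vert>z\<Vert>\<^bsub>F\<^esub>" using ft[OF scale_closed[OF z], of "-1"] by linarith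
  moreover have "f (of_real (-1) \<odot>\<^bsub>F\<^esub> z) = (-1) * f z"
    using f z unfolding real_linear_def by blast
  ultimately have "f z = \<Vert>z\<Vert>\<^bsub>F\<^esub>" using le[OF z] by simp
  with f le show ?thesis by blast
qed

end

text \<open>The form \<open>(l, k) \<mapsto> (l k) \<bullet> 1\<close> is nondegenerate, as \<open>l = k\<^bsup>-1\<^esup>\<close> gives the value \<open>1\<close>. So the
  linear map \<open>M\<close> that sends \<open>k\<close> to the coordinates of the functional it represents is injective,
  and by finite dimension it is surjective.\<close>

lemma scalar_representation:
  fixes g :: "'k::{real_normed_field, euclidean_space} \<Rightarrow> real"
  assumes "linear g"
  shows "\<exists>!k. \<forall>l. (l * k) \<bullet> 1 = g l"
proof -
  define M :: "'k \<Rightarrow> 'k" where "M k = (\<Sum>b\<in>Basis. ((b * k) \<bullet> 1) *\<^sub>R b)" for k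
  have M_inner: "M k \<bullet> b = (b * k) \<bullet> 1" if "b \<in> Basis" for k b
    using that by (simp add: M_def inner_sum_left inner_Basis if_distrib sum.delta cong: if_cong)
  have lin: "linear (\<lambda>l. (l * k) \<bullet> 1)" for k :: 'k
    by (rule linearI) (simp_all add: distrib_right inner_add_left)
  have ext: "h l = h' l" if "linear h" "linear h'" "\<And>b. b \<in> Basis \<Longrightarrow> h b = h' b"
    for h h' :: "'k \<Rightarrow> real" and l
    using linear_eq_stdbasis[OF that] by simp
  have zero: "k = 0" if "\<And>l. (l * k) \<bullet> 1 = 0" for k :: 'k
  proof (rule ccontr)
    assume "k \<noteq> 0"
    then show False using that[of "inverse k"] by (simp add: dot_square_norm)
  qed
  have "linear M"
    unfolding M_def
    by (rule linearI)
      (simp_all add: distrib_left inner_add_left scaleR_add_left sum.distrib scaleR_sum_right)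
  moreover have "k = 0" if "M k = 0" for k
    using zero[of k] ext[OF lin[of k] linear_zero] M_inner[of _ k] that by simp
  ultimately have "surj M"
    using linear_injective_imp_surjective linear_injective_0 by blast
  then obtain k where k: "M k = (\<Sum>b\<in>Basis. g b *\<^sub>R b)" by (metis surjD)
  have "(b * k) \<bullet> 1 = g b" if "b \<in> Basis" for b
    using M_inner[OF that, of k] k that
    by (simp add: inner_sum_left inner_Basis if_distrib sum.delta cong: if_cong)
  then have "(l * k) \<bullet> 1 = g l" for l
    using ext[OF lin assms] by blast
  moreover have "k' = k" if "\<forall>l. (l * k') \<bullet> 1 = g l" for k'
    using zero[of "k' - k"] that calculation by (simp add: algebra_simps inner_diff_left)
  ultimately show ?thesis by blast
qed

context banach_carrier
begin

text \<open>Given a real functional \<open>f\<close> that norms \<open>z\<close>, let \<open>a x\<close> be the scalar that represents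
  \<open>l \<mapsto> f (l x)\<close>. Uniqueness of the representation makes \<open>a\<close> linear over the scalars. With
  \<open>l = (a x)\<^bsup>-1\<^esup>\<close> it gives \<open>1 = f ((a x)\<^bsup>-1\<^esup> x) \<le> \<parallel>x\<parallel> / \<bar>a x\<bar>\<close>, so the norm of \<open>a\<close> is at most \<open>1\<close>,
  and with \<open>l = 1\<close> it gives \<open>\<bar>a z\<bar> \<ge> (a z) \<bullet> 1 = f z = \<parallel>z\<parallel>\<close>.\<close>

lemma norming_functional:
  assumes z: "z \<in> carrier F"
  obtains a where "a \<in> dual_ball F" "\<Vert>z\<Vert>\<^bsub>F\<^esub> \<le> norm (a z)"
proof -
  obtain f where f: "\<And>x y. x \<in> carrier F \<Longrightarrow> y \<in> carrier F \<Longrightarrow> f (x \<oplus>\<^bsub>F\<^esub> y) = f x + f y"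
    "\<And>t x. x \<in> carrier F \<Longrightarrow> f (of_real t \<odot>\<^bsub>F\<^esub> x) = t * f x"
    "\<And>x. x \<in> carrier F \<Longrightarrow> f x \<le> \<Vert>x\<Vert>\<^bsub>F\<^esub>"
    "f z = \<Vert>z\<Vert>\<^bsub>F\<^esub>"
    using norming_real_functional[OF z] unfolding real_linear_def by blast
  define a where "a = (\<lambda>x\<in>carrier F. THE k. \<forall>l. (l * k) \<bullet> 1 = f (l \<odot>\<^bsub>F\<^esub> x))"
  have ex1: "\<exists>!k. \<forall>l. (l * k) \<bullet> 1 = f (l \<odot>\<^bsub>F\<^esub> x)" if x: "x \<in> carrier F" for x
  proof (rule scalar_representation, rule linearI)
    show "f ((c + d) \<odot>\<^bsub>F\<^esub> x) = f (c \<odot>\<^bsub>F\<^esub> x) + f (d \<odot>\<^bsub>F\<^esub> x)" for c d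
      using x by (simp add: scale_add_left f(1))
    show "f ((r *\<^sub>R c) \<odot>\<^bsub>F\<^esub> x) = r *\<^sub>R f (c \<odot>\<^bsub>F\<^esub> x)" for r c
      using f(2)[OF scale_closed[OF x], of r c] x by (simp add: scale_scale scaleR_conv_of_real)
  qed
  have a: "(l * a x) \<bullet> 1 = f (l \<odot>\<^bsub>F\<^esub> x)" if "x \<in> carrier F" for l x
    using theI'[OF ex1[OF that]] that by (simp add: a_def)
  have unique: "a x = k" if "x \<in> carrier F" "\<And>l. (l * k) \<bullet> 1 = f (l \<odot>\<^bsub>F\<^esub> x)" for x k
    using ex1[OF that(1)] a[OF that(1)] that(2) by blast
  have bound: "norm (a x) \<le> \<Vert>x\<Vert>\<^bsub>F\<^esub>" if x: "x \<in> carrier F" for x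
  proof (cases "a x = 0")
    case False
    have "1 = f (inverse (a x) \<odot>\<^bsub>F\<^esub> x)"
      using a[OF x, of "inverse (a x)"] False by (simp add: dot_square_norm)
    also have "\<dots> \<le> inverse (norm (a x)) * \<Vert>x\<Vert>\<^bsub>F\<^esub>"
      using f(3)[OF scale_closed[OF x], of "inverse (a x)"] x by (simp add: norm_scale norm_inverse)
    finally show ?thesis using False by (simp add: field_simps)
  qed (simp add: norm_nonneg x)
  have "a \<in> bounded_ops F scalar_space"
    unfolding bounded_ops_def
  proof (intro CollectI conjI ballI allI)
    show "a \<in> carrier F \<rightarrow>\<^sub>E carrier scalar_space" by (simp add: a_def)
    show "a (x \<oplus>\<^bsub>F\<^esub> y) = a x \<oplus>\<^bsub>scalar_space\<^esub> a y" if "x \<in> carrier F" "y \<in> carrier F" for x y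
      using that by (intro unique) (simp_all add: a f(1) scale_add_right distrib_left inner_add_left)
    show "a (c \<odot>\<^bsub>F\<^esub> x) = c \<odot>\<^bsub>scalar_space\<^esub> a x" if "x \<in> carrier F" for c x
    proof -
      have "a (c \<odot>\<^bsub>F\<^esub> x) = c * a x"
        using that a[OF that, of "_ * c"] by (intro unique) (simp_all add: scale_scale mult.assoc)
      then show ?thesis by (simp add: scalar_space_def)
    qed
    show "\<exists>C. \<forall>x\<in>carrier F. \<Vert>a x\<Vert>\<^bsub>scalar_space\<^esub> \<le> C * \<Vert>x\<Vert>\<^bsub>F\<^esub>"
      using bound by (intro exI[of _ 1]) (simp add: scalar_space_def)
  qed
  moreover have "op_norm F scalar_space a \<le> 1"
    unfolding op_norm_def
    using bound by (intro cInf_lower) (auto simp: scalar_space_def intro: bdd_belowI[of _ 0])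
  ultimately have "a \<in> dual_ball F" by (simp add: dual_ball_def)
  moreover have "\<Vert>z\<Vert>\<^bsub>F\<^esub> \<le> norm (a z)"
    using a[OF z, of 1] f(4) z Cauchy_Schwarz_ineq2[of "a z" 1] by simp
  ultimately show thesis using that by blast
qed

text \<open>Some functional in the dual ball norms \<open>x - y\<close>, and its value at \<open>x - y\<close> is a coordinate of
  \<open>J\<^sub>F x - J\<^sub>F y\<close>.\<close>

lemma norm_diff_le_inj_emb:
  assumes x: "x \<in> carrier F" and y: "y \<in> carrier F"
  shows "\<Vert>x \<ominus>\<^bsub>F\<^esub> y\<Vert>\<^bsub>F\<^esub> \<le> \<Vert>inj_emb F x \<ominus>\<^bsub>inj_space F\<^esub> inj_emb F y\<Vert>\<^bsub>inj_space F\<^esub>"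
proof -
  interpret I: banach_carrier "inj_space F"
    by unfold_locales (simp add: inj_space_def banach_linfty)
  have J: "inj_emb F x \<in> carrier (inj_space F)" "inj_emb F y \<in> carrier (inj_space F)"
    using inj_emb_carrier[OF banach] x y by auto
  obtain a where a: "a \<in> dual_ball F" "\<Vert>x \<ominus>\<^bsub>F\<^esub> y\<Vert>\<^bsub>F\<^esub> \<le> norm (a (x \<ominus>\<^bsub>F\<^esub> y))"
    using norming_functional[of "x \<ominus>\<^bsub>F\<^esub> y"] x y by auto
  have "a (x \<ominus>\<^bsub>F\<^esub> y) = a x \<oplus>\<^bsub>scalar_space\<^esub> ((-1) \<odot>\<^bsub>scalar_space\<^esub> a y)"
    using a(1) x y by (simp add: minus_conv_scale dual_ball_def bounded_ops_def del: scalar_simps)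
  then have "a (x \<ominus>\<^bsub>F\<^esub> y) = a x - a y" by (simp add: scalar_space_def)
  also have "\<dots> = (inj_emb F x \<ominus>\<^bsub>inj_space F\<^esub> inj_emb F y) a"
    using J x y a(1) unfolding inj_space_def by (simp add: linfty_minus inj_emb_def)
  finally show ?thesis
    using a linfty_norm_ge[of "inj_emb F x \<ominus>\<^bsub>inj_space F\<^esub> inj_emb F y" "dual_ball F" a]
      I.M.minus_closed[OF J] unfolding inj_space_def by simp
qed

end

section \<open>Interpolation of nonlinear ideals\<close>

lemma isometric_iso_diff:
  assumes "banach_space F" "banach_space G" "isometric_iso F G \<Phi>" "x \<in> carrier F" "y \<in> carrier F"
  shows "\<Vert>\<Phi> x \<ominus>\<^bsub>G\<^esub> \<Phi> y\<Vert>\<^bsub>G\<^esub> = \<Vert>x \<ominus>\<^bsub>F\<^esub> y\<Vert>\<^bsub>F\<^esub>"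
proof -
  interpret F: banach_carrier F by unfold_locales fact
  interpret G: banach_carrier G by unfold_locales fact
  have "\<Phi> x \<in> carrier G" "\<Phi> y \<in> carrier G"
    using assms(3-5) by (auto simp: isometric_iso_def bounded_ops_def)
  then have "\<Phi> x \<ominus>\<^bsub>G\<^esub> \<Phi> y = \<Phi> (x \<ominus>\<^bsub>F\<^esub> y)"
    using assms(3-5) by (simp add: isometric_iso_def bounded_ops_def F.minus_conv_scale G.minus_conv_scale)
  then show ?thesis using assms(3-5) by (simp add: isometric_iso_def)
qed

lemma Lip_bound:
  assumes "banach_space F" "T \<in> Lip X (npointed F)"
  obtains L where "0 \<le> L"
    "\<And>x y. x \<in> points X \<Longrightarrow> y \<in> points X \<Longrightarrow> \<Vert>T x \<ominus>\<^bsub>F\<^esub> T y\<Vert>\<^bsub>F\<^esub> \<le> L * mdist (fst X) x y"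
proof -
  interpret banach_carrier F by unfold_locales fact
  obtain B where B: "\<And>x y. x \<in> points X \<Longrightarrow> y \<in> points X \<Longrightarrow>
      mdist (nmetric F) (T x) (T y) \<le> B * mdist (fst X) x y"
    using assms(2) by (auto simp: Lip_def Lipschitz_continuous_map_def npointed_def)
  have "\<Vert>T x \<ominus>\<^bsub>F\<^esub> T y\<Vert>\<^bsub>F\<^esub> \<le> max 0 B * mdist (fst X) x y" if "x \<in> points X" "y \<in> points X" for x y
  proof -
    have "\<Vert>T x \<ominus>\<^bsub>F\<^esub> T y\<Vert>\<^bsub>F\<^esub> \<le> B * mdist (fst X) x y"
      using B[OF that] mdist_nmetric Lip_carrier[OF assms] that by simp
    also have "\<dots> \<le> max 0 B * mdist (fst X) x y" by (intro mult_right_mono) simp_all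
    finally show ?thesis .
  qed
  then show thesis using that[of "max 0 B"] by simp
qed

text \<open>Multiplication by a scalar is a bounded operator.\<close>

lemma ideal_scale:
  assumes ideal: "normed_nonlinear_ideal \<AA> \<alpha>" and X: "pointed X" and F: "banach_space F"
    and T: "T \<in> \<AA> X F"
  shows "(\<lambda>x\<in>points X. c \<odot>\<^bsub>F\<^esub> T x) \<in> \<AA> X F"
proof -
  interpret banach_carrier F by unfold_locales fact
  let ?B = "\<lambda>x\<in>carrier F. c \<odot>\<^bsub>F\<^esub> x"
  have TL: "T \<in> Lip X (npointed F)"
    using ideal X F T unfolding normed_nonlinear_ideal_def by blast
  have "?B \<in> bounded_ops F F"
    unfolding bounded_ops_def
    by (auto simp: scale_add_right scale_scale mult.commute norm_scale intro!: exI[of _ "norm c"])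
  then have "(\<lambda>x\<in>points X. ?B (T (restrict id (points X) x))) \<in> \<AA> X F"
    using ideal X F T id_Lip[OF X] unfolding normed_nonlinear_ideal_def by blast
  moreover have "(\<lambda>x\<in>points X. ?B (T (restrict id (points X) x))) = (\<lambda>x\<in>points X. c \<odot>\<^bsub>F\<^esub> T x)"
    using Lip_carrier[OF F TL] by (auto simp: restrict_def)
  ultimately show ?thesis by simp
qed

text \<open>With a Lipschitz constant \<open>L\<close> of \<open>S\<close>,
  \<open>s\<^bsup>1-\<theta>\<^esup> d\<^bsup>\<theta>\<^esup> = s\<^bsup>1-\<eta>\<^esup> s\<^bsup>\<eta>-\<theta>\<^esup> d\<^bsup>\<theta>\<^esup> \<le> L\<^bsup>\<eta>-\<theta>\<^esup> s\<^bsup>1-\<eta>\<^esup> d\<^bsup>\<eta>\<^esup>\<close>.\<close>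

lemma interp_mono:
  fixes \<AA> :: "('m, 'k::{real_normed_field, euclidean_space}, 'u) components"
    and F :: "('k, 'v) nspace"
  assumes ideal: "normed_nonlinear_ideal \<AA> \<alpha>" and X: "pointed X"
    and \<eta>: "\<theta> \<le> \<eta>" "\<eta> < 1"
  shows "interp \<theta> \<AA> X F \<subseteq> interp \<eta> \<AA> X F"
proof
  fix T assume "T \<in> interp \<theta> \<AA> X F"
  then obtain G S where T: "T \<in> Lip X (npointed F)" and G: "banach_space G" and S: "S \<in> \<AA> X G"
    and TS: "\<And>x y. x \<in> points X \<Longrightarrow> y \<in> points X \<Longrightarrow> \<Vert>T x \<ominus>\<^bsub>F\<^esub> T y\<Vert>\<^bsub>F\<^esub>
      \<le> \<Vert>S x \<ominus>\<^bsub>G\<^esub> S y\<Vert>\<^bsub>G\<^esub> powr (1 - \<theta>) * mdist (fst X) x y powr \<theta>"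
    unfolding interp_def by blast
  interpret G: banach_carrier G by unfold_locales fact
  have SL: "S \<in> Lip X (npointed G)"
    using ideal X G S unfolding normed_nonlinear_ideal_def by blast
  obtain L where L: "0 \<le> L" and SLip: "\<And>x y. x \<in> points X \<Longrightarrow> y \<in> points X \<Longrightarrow>
      \<Vert>S x \<ominus>\<^bsub>G\<^esub> S y\<Vert>\<^bsub>G\<^esub> \<le> L * mdist (fst X) x y"
    using Lip_bound[OF G SL] by blast
  \<comment> \<open>The factor is chosen such that \<open>M powr (1 - \<eta>) = L powr (\<eta> - \<theta>)\<close>.\<close>
  define M where "M = L powr ((\<eta> - \<theta>) / (1 - \<eta>))"
  let ?S = "\<lambda>x\<in>points X. of_real M \<odot>\<^bsub>G\<^esub> S x"
  have "\<Vert>T x \<ominus>\<^bsub>F\<^esub> T y\<Vert>\<^bsub>F\<^esub> \<le> \<Vert>?S x \<ominus>\<^bsub>G\<^esub> ?S y\<Vert>\<^bsub>G\<^esub> powr (1 - \<eta>) * mdist (fst X) x y powr \<eta>"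
    if x: "x \<in> points X" and y: "y \<in> points X" for x y
  proof -
    let ?s = "\<Vert>S x \<ominus>\<^bsub>G\<^esub> S y\<Vert>\<^bsub>G\<^esub>" and ?d = "mdist (fst X) x y"
    have Sxy: "S x \<in> carrier G" "S y \<in> carrier G" using Lip_carrier[OF G SL] x y by auto
    then have s: "0 \<le> ?s" by (simp add: G.norm_nonneg)
    have "\<Vert>?S x \<ominus>\<^bsub>G\<^esub> ?S y\<Vert>\<^bsub>G\<^esub> = M * ?s"
      using Sxy x y by (simp add: G.scale_minus G.norm_scale M_def)
    then have M: "\<Vert>?S x \<ominus>\<^bsub>G\<^esub> ?S y\<Vert>\<^bsub>G\<^esub> powr (1 - \<eta>) = L powr (\<eta> - \<theta>) * ?s powr (1 - \<eta>)"
      using s L \<eta> by (simp add: M_def powr_mult powr_powr)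
    have "\<Vert>T x \<ominus>\<^bsub>F\<^esub> T y\<Vert>\<^bsub>F\<^esub> \<le> ?s powr (1 - \<theta>) * ?d powr \<theta>" by (rule TS[OF x y])
    also have "\<dots> = ?s powr (1 - \<eta>) * ?s powr (\<eta> - \<theta>) * ?d powr \<theta>"
      by (simp flip: powr_add)
    also have "\<dots> \<le> ?s powr (1 - \<eta>) * (L * ?d) powr (\<eta> - \<theta>) * ?d powr \<theta>"
      using SLip[OF x y] s \<eta> by (intro mult_right_mono mult_left_mono powr_mono2) simp_all
    also have "\<dots> = L powr (\<eta> - \<theta>) * ?s powr (1 - \<eta>) * (?d powr (\<eta> - \<theta>) * ?d powr \<theta>)"
      using L by (simp add: powr_mult)
    also have "\<dots> = \<Vert>?S x \<ominus>\<^bsub>G\<^esub> ?S y\<Vert>\<^bsub>G\<^esub> powr (1 - \<eta>) * ?d powr \<eta>"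
      unfolding M by (simp flip: powr_add)
    finally show ?thesis .
  qed
  then show "T \<in> interp \<eta> \<AA> X F"
    using T G ideal_scale[OF ideal X G S, of "of_real M"] unfolding interp_def by blast
qed

text \<open>The points \<open>x = y\<close> are treated separately because there the factor \<open>d powr 0\<close> is \<open>0\<close>.\<close>

lemma inj_hull_subset_interp_0:
  fixes \<AA> :: "('m, 'k::{real_normed_field, euclidean_space}, 'u) components"
    and F :: "('k, 'v) nspace"
  assumes F: "banach_space F"
  shows "inj_hull \<AA> X F \<subseteq> interp 0 \<AA> X F"
proof
  fix T assume "T \<in> inj_hull \<AA> X F"
  then obtain H \<Phi> where T: "T \<in> Lip X (npointed F)" and H: "banach_space H"
      and iso: "isometric_iso (inj_space F) H \<Phi>"
      and mem: "(\<lambda>x\<in>points X. \<Phi> (inj_emb F (T x))) \<in> \<AA> X H"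
    unfolding inj_hull_def by blast
  interpret F: banach_carrier F by unfold_locales fact
  have I: "banach_space (inj_space F)" by (simp add: inj_space_def banach_linfty)
  let ?S = "\<lambda>x\<in>points X. \<Phi> (inj_emb F (T x))"
  have "\<Vert>T x \<ominus>\<^bsub>F\<^esub> T y\<Vert>\<^bsub>F\<^esub> \<le> \<Vert>?S x \<ominus>\<^bsub>H\<^esub> ?S y\<Vert>\<^bsub>H\<^esub> powr (1 - 0) * mdist (fst X) x y powr 0"
    if x: "x \<in> points X" and y: "y \<in> points X" for x y
  proof (cases "x = y")
    case True
    have "\<Vert>T x \<ominus>\<^bsub>F\<^esub> T x\<Vert>\<^bsub>F\<^esub> = 0"
      using Lip_carrier[OF F T x] F.sublinear_zero[OF F.sublinear_norm]
      by (simp add: F.minus_conv_scale F.add_scale_minus_one)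
    then show ?thesis using True x by simp
  next
    case False
    have Txy: "T x \<in> carrier F" "T y \<in> carrier F" using Lip_carrier[OF F T] x y by auto
    have "\<Vert>T x \<ominus>\<^bsub>F\<^esub> T y\<Vert>\<^bsub>F\<^esub> \<le> \<Vert>?S x \<ominus>\<^bsub>H\<^esub> ?S y\<Vert>\<^bsub>H\<^esub>"
      using F.norm_diff_le_inj_emb[OF Txy] x y
        isometric_iso_diff[OF I H iso] inj_emb_carrier[OF F] Txy by simp
    moreover have "0 \<le> \<Vert>T x \<ominus>\<^bsub>F\<^esub> T y\<Vert>\<^bsub>F\<^esub>" using Txy by (simp add: F.norm_nonneg)
    moreover have "mdist (fst X) x y \<noteq> 0" using False x y by simp
    ultimately show ?thesis by simp
  qed
  then show "T \<in> interp 0 \<AA> X F" using T H mem unfolding interp_def by blast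
qed

text \<open>The exponents match as \<open>1 - (\<theta> + \<eta> - \<theta> \<eta>) = (1 - \<theta>) (1 - \<eta>)\<close>.\<close>

lemma interp_interp:
  fixes \<AA> :: "('m, 'k::{real_normed_field, euclidean_space}, 'u) components"
    and F :: "('k, 'v) nspace"
  assumes \<eta>: "\<eta> < 1"
  shows "interp \<eta> (interp \<theta> \<AA> :: ('m, 'k, 'u) components) X F \<subseteq> interp (\<theta> + \<eta> - \<theta> * \<eta>) \<AA> X F"
proof
  fix T assume "T \<in> interp \<eta> (interp \<theta> \<AA> :: ('m, 'k, 'u) components) X F"
  then obtain G :: "('k, 'u) nspace" and S where T: "T \<in> Lip X (npointed F)"
    and G: "banach_space G" and S: "S \<in> interp \<theta> \<AA> X G"
    and TS: "\<And>x y. x \<in> points X \<Longrightarrow> y \<in> points X \<Longrightarrow> \<Vert>T x \<ominus>\<^bsub>F\<^esub> T y\<Vert>\<^bsub>F\<^esub>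
      \<le> \<Vert>S x \<ominus>\<^bsub>G\<^esub> S y\<Vert>\<^bsub>G\<^esub> powr (1 - \<eta>) * mdist (fst X) x y powr \<eta>"
    unfolding interp_def[of \<eta>] by blast
  then obtain H R where SL: "S \<in> Lip X (npointed G)" and H: "banach_space H" and R: "R \<in> \<AA> X H"
    and SR: "\<And>x y. x \<in> points X \<Longrightarrow> y \<in> points X \<Longrightarrow> \<Vert>S x \<ominus>\<^bsub>G\<^esub> S y\<Vert>\<^bsub>G\<^esub>
      \<le> \<Vert>R x \<ominus>\<^bsub>H\<^esub> R y\<Vert>\<^bsub>H\<^esub> powr (1 - \<theta>) * mdist (fst X) x y powr \<theta>"
    unfolding interp_def[of \<theta>] by blast
  interpret G: banach_carrier G by unfold_locales fact
  have "\<Vert>T x \<ominus>\<^bsub>F\<^esub> T y\<Vert>\<^bsub>F\<^esub> \<le> \<Vert>R x \<ominus>\<^bsub>H\<^esub> R y\<Vert>\<^bsub>H\<^esub> powr (1 - (\<theta> + \<eta> - \<theta> * \<eta>))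
      * mdist (fst X) x y powr (\<theta> + \<eta> - \<theta> * \<eta>)"
    if x: "x \<in> points X" and y: "y \<in> points X" for x y
  proof -
    let ?r = "\<Vert>R x \<ominus>\<^bsub>H\<^esub> R y\<Vert>\<^bsub>H\<^esub>" and ?s = "\<Vert>S x \<ominus>\<^bsub>G\<^esub> S y\<Vert>\<^bsub>G\<^esub>" and ?d = "mdist (fst X) x y"
    have s: "0 \<le> ?s" using Lip_carrier[OF G SL] x y by (simp add: G.norm_nonneg)
    have "\<Vert>T x \<ominus>\<^bsub>F\<^esub> T y\<Vert>\<^bsub>F\<^esub> \<le> ?s powr (1 - \<eta>) * ?d powr \<eta>" by (rule TS[OF x y])
    also have "\<dots> \<le> (?r powr (1 - \<theta>) * ?d powr \<theta>) powr (1 - \<eta>) * ?d powr \<eta>"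
      using SR[OF x y] s \<eta> by (intro mult_right_mono powr_mono2) simp_all
    also have "\<dots> = ?r powr ((1 - \<theta>) * (1 - \<eta>)) * (?d powr (\<theta> * (1 - \<eta>)) * ?d powr \<eta>)"
      by (simp add: powr_mult powr_powr)
    also have "\<dots> = ?r powr ((1 - \<theta>) * (1 - \<eta>)) * ?d powr (\<theta> * (1 - \<eta>) + \<eta>)"
      by (simp only: powr_add)
    also have "\<dots> = ?r powr (1 - (\<theta> + \<eta> - \<theta> * \<eta>)) * ?d powr (\<theta> + \<eta> - \<theta> * \<eta>)"
      by (simp add: algebra_simps)
    finally show ?thesis .
  qed
  then show "T \<in> interp (\<theta> + \<eta> - \<theta> * \<eta>) \<AA> X F" using T H R unfolding interp_def by blast
qed

theorem proposition21:
  fixes \<AA> :: "('m, 'k::{real_normed_field, euclidean_space}, 'u) components"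
    and \<alpha> :: "'m pmetric \<Rightarrow> ('k, 'u) nspace \<Rightarrow> ('m \<Rightarrow> 'u) \<Rightarrow> real"
    and \<theta> \<theta>\<^sub>1 \<theta>\<^sub>2 :: real
    and X :: "'m pmetric"
    and F :: "('k, 'v) nspace"
  assumes "normed_nonlinear_ideal \<AA> \<alpha>"
    and "0 \<le> \<theta>" "\<theta> < 1" "0 \<le> \<theta>\<^sub>1" "\<theta>\<^sub>1 < 1" "0 \<le> \<theta>\<^sub>2" "\<theta>\<^sub>2 < 1"
    and "pointed X" "banach_space F"
  shows "(\<theta>\<^sub>1 \<le> \<theta>\<^sub>2 \<longrightarrow> interp \<theta>\<^sub>1 \<AA> X F \<subseteq> interp \<theta>\<^sub>2 \<AA> X F) \<and>
         inj_hull \<AA> X F \<subseteq> interp \<theta> \<AA> X F \<and>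
         interp \<theta>\<^sub>2 (interp \<theta>\<^sub>1 \<AA> :: ('m, 'k, 'u) components) X F
           \<subseteq> interp (\<theta>\<^sub>1 + \<theta>\<^sub>2 - \<theta>\<^sub>1 * \<theta>\<^sub>2) \<AA> X F"
proof (intro conjI impI)
  show "interp \<theta>\<^sub>1 \<AA> X F \<subseteq> interp \<theta>\<^sub>2 \<AA> X F" if "\<theta>\<^sub>1 \<le> \<theta>\<^sub>2"
    using interp_mono[OF assms(1,8) that assms(7)] .
  show "inj_hull \<AA> X F \<subseteq> interp \<theta> \<AA> X F"
    using inj_hull_subset_interp_0[OF assms(9)] interp_mono[OF assms(1,8,2,3)] by blast
  show "interp \<theta>\<^sub>2 (interp \<theta>\<^sub>1 \<AA> :: ('m, 'k, 'u) components) X F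
      \<subseteq> interp (\<theta>\<^sub>1 + \<theta>\<^sub>2 - \<theta>\<^sub>1 * \<theta>\<^sub>2) \<AA> X F"
    using interp_interp[OF assms(7)] .
qed

end
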